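(* Let $\delta, \varepsilon \in \mathbb{R}$ with $0 < \delta \leq \varepsilon \leq 1$ and let $p \in [1,\infty)$. There is a polynomial-time mapping reduction from $(\delta,\varepsilon)$-NAE-E3-SAT to $\gamma$-$\mathrm{BinGapCRP}_p$ for \[\gamma = \gamma(\delta,\varepsilon,p) := \Big(\frac{\delta\cdot 10/2^p + (1-\delta)\cdot((3/2)^p + 9/2^p)}{\varepsilon\cdot(4/3)^p + (1-\varepsilon)2^p + 3(2 + (4/3)^p)}\Big)^{1/p}.\]
   Context: An NAE-E3-SAT formula $\phi$ consists of Boolean variables $v_1,\dots,v_n$ and constraints $C_1,\dots,C_m$, each a function of exactly $3$ distinct literals (variables or their negations); a constraint is satisfied iff its three literals do not all evaluate to the same value. $\mathrm{val}(\phi)$ is the maximum over assignments of the fraction of satisfied constraints. For $0<\delta\le\varepsilon\le1$, $(\delta,\varepsilon)$-NAE-E3-SAT is the promise problem of distinguishing $\mathrm{val}(\phi)\ge\varepsilon$ (YES) from $\mathrm{val}(\phi)<\delta$ (NO). For $B\in\mathbb{R}^{m\times n}$, $\mathrm{lindisc}_p(B) := \max_{w\in[0,1]^n}\min_{x\in\{0,1\}^n}\|B(w-x)\|_p$; for a basis $B$ (full column rank), $\mu_p(\mathcal{L}(B)) := \max_{w\in[0,1]^n}\min_{x\in\mathbb{Z}^n}\|B(w-x)\|_p$ is the $\ell_p$ covering radius of the lattice $\mathcal{L}(B)=B\mathbb{Z}^n$. $\gamma$-$\mathrm{BinGapCRP}_p$ is the promise problem: given a basis $B$ and $r>0$, distinguish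 YES instances with $\mathrm{lindisc}_p(B)\le r$ from NO instances with $\mu_p(\mathcal{L}(B))>\gamma r$. *)

theory Defs
  imports
    Complex_Main
    "HOL-Computational_Algebra.Polynomial"
    "Jordan_Normal_Form.DL_Rank"
begin

section \<open>Deterministic multi-tape Turing machines\<close>

text \<open>
  The tape alphabet is the finite type \<^typ>\<open>char option\<close>, with \<^term>\<open>None\<close> as the blank.
  The control states are \<open>0, ..., num_states M\<close>, where \<open>0\<close> is initial and \<open>num_states M\<close> is
  the only halting state. Only the finitely many values of \<open>delta M\<close> on states below
  \<open>num_states M\<close> and on lists of \<open>num_tapes M\<close> symbols matter, so this is a finite table.
\<close>

datatype move = MoveLeft | Stay | MoveRight

record tm =
  num_tapes :: nat
  num_states :: nat
  delta :: "nat \<Rightarrow> char option list \<Rightarrow> nat \<times> (char option \<times> move) list"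

definition wf_tm :: "tm \<Rightarrow> bool" where
  "wf_tm M \<longleftrightarrow> 0 < num_tapes M \<and>
     (\<forall>q < num_states M. \<forall>ss. length ss = num_tapes M \<longrightarrow>
        fst (delta M q ss) \<le> num_states M \<and> length (snd (delta M q ss)) = num_tapes M)"

text \<open>A tape is two-way infinite and consists of its contents and its head position.\<close>

type_synonym tape = "(int \<Rightarrow> char option) \<times> int"
type_synonym config = "nat \<times> tape list"

definition read_tape :: "tape \<Rightarrow> char option" where
  "read_tape t = fst t (snd t)"

fun offset :: "move \<Rightarrow> int" where
  "offset MoveLeft = -1"
| "offset Stay = 0"
| "offset MoveRight = 1"

definition act_tape :: "char option \<times> move \<Rightarrow> tape \<Rightarrow> tape" where
  "act_tape a t = ((fst t)(snd t := fst a), snd t + offset (snd a))"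

definition tm_step :: "tm \<Rightarrow> config \<Rightarrow> config" where
  "tm_step M cfg = (case cfg of (q, ts) \<Rightarrow>
     if q < num_states M
     then (case delta M q (map read_tape ts) of (q', as) \<Rightarrow> (q', map2 act_tape as ts))
     else (q, ts))"

definition word_on_tape :: "string \<Rightarrow> int \<Rightarrow> char option" where
  "word_on_tape w = (\<lambda>i. if 0 \<le> i \<and> i < int (length w) then Some (w ! nat i) else None)"

definition init_config :: "tm \<Rightarrow> string \<Rightarrow> config" where
  "init_config M w =
     (0, (word_on_tape w, 0) # replicate (num_tapes M - 1) (word_on_tape [], 0))"

text \<open>The input is on the first tape; on halting, the last tape holds exactly the output.\<close>

definition computes_within :: "tm \<Rightarrow> string \<Rightarrow> string \<Rightarrow> nat \<Rightarrow> bool" where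
  "computes_within M x y T \<longleftrightarrow> (\<exists>t\<le>T.
     case (tm_step M ^^ t) (init_config M x) of (q, ts) \<Rightarrow>
       q = num_states M \<and> fst (last ts) = word_on_tape y)"


section \<open>Promise problems and polynomial-time mapping reductions\<close>

record 'i promise_problem =
  instances :: "'i set"
  encode :: "'i \<Rightarrow> string"
  YES :: "'i set"
  NO :: "'i set"

definition polytime_map ::
  "'i promise_problem \<Rightarrow> 'j promise_problem \<Rightarrow> ('i \<Rightarrow> 'j) \<Rightarrow> bool" where
  "polytime_map A B f \<longleftrightarrow> (\<exists>M (P :: nat poly). wf_tm M \<and>
     (\<forall>x \<in> instances A.
        computes_within M (encode A x) (encode B (f x)) (poly P (length (encode A x)))))"

definition polytime_mapping_reduction ::
  "'i promise_problem \<Rightarrow> 'j promise_problem \<Rightarrow> ('i \<Rightarrow> 'j) \<Rightarrow> bool" where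
  "polytime_mapping_reduction A B f \<longleftrightarrow>
     polytime_map A B f \<and>
     (\<forall>x \<in> instances A. f x \<in> instances B) \<and>
     (\<forall>x \<in> YES A. f x \<in> YES B) \<and>
     (\<forall>x \<in> NO A. f x \<in> NO B)"

definition polytime_reducible ::
  "'i promise_problem \<Rightarrow> 'j promise_problem \<Rightarrow> bool" where
  "polytime_reducible A B \<longleftrightarrow> (\<exists>f. polytime_mapping_reduction A B f)"


section \<open>Encodings of numbers\<close>

text \<open>Binary notation, most significant digit first.\<close>

fun enc_nat :: "nat \<Rightarrow> string" where
  "enc_nat n = (if n < 2 then [] else enc_nat (n div 2)) @ (if even n then ''0'' else ''1'')"

declare enc_nat.simps [simp del]

definition enc_int :: "int \<Rightarrow> string" where
  "enc_int k = (if k < 0 then ''-'' else []) @ enc_nat (nat \<bar>k\<bar>)"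

text \<open>Reduced fractions with positive denominator.\<close>

definition enc_rat :: "rat \<Rightarrow> string" where
  "enc_rat q = enc_int (fst (quotient_of q)) @ ''/'' @ enc_int (snd (quotient_of q))"

text \<open>
  Radii are real numbers that are in general irrational (typically they are \<open>p\<close>-th roots), so
  they are written as closed-form expressions, built from natural numbers in binary and from
  names \<open>Par i\<close> for the entries of a fixed finite list of real constants. These constants
  belong to the problem and not to the input.
\<close>

datatype rexp =
    Num nat
  | Par nat
  | Add rexp rexp
  | Sub rexp rexp
  | Mul rexp rexp
  | Div rexp rexp
  | Pow rexp rexp

fun rexp_val :: "real list \<Rightarrow> rexp \<Rightarrow> real" where
  "rexp_val cs (Num n) = real n"
| "rexp_val cs (Par i) = (if i < length cs then cs ! i else 0)"
| "rexp_val cs (Add a b) = rexp_val cs a + rexp_val cs b"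
| "rexp_val cs (Sub a b) = rexp_val cs a - rexp_val cs b"
| "rexp_val cs (Mul a b) = rexp_val cs a * rexp_val cs b"
| "rexp_val cs (Div a b) = rexp_val cs a / rexp_val cs b"
| "rexp_val cs (Pow a b) = rexp_val cs a powr rexp_val cs b"

text \<open>Prefix notation.\<close>

fun enc_rexp :: "rexp \<Rightarrow> string" where
  "enc_rexp (Num n) = enc_nat n @ ''.''"
| "enc_rexp (Par i) = ''c'' @ enc_nat i @ ''.''"
| "enc_rexp (Add a b) = ''+'' @ enc_rexp a @ enc_rexp b"
| "enc_rexp (Sub a b) = ''-'' @ enc_rexp a @ enc_rexp b"
| "enc_rexp (Mul a b) = ''*'' @ enc_rexp a @ enc_rexp b"
| "enc_rexp (Div a b) = ''/'' @ enc_rexp a @ enc_rexp b"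
| "enc_rexp (Pow a b) = ''^'' @ enc_rexp a @ enc_rexp b"


section \<open>NAE-E3-SAT\<close>

datatype literal = Pos nat | Neg nat

fun lit_var :: "literal \<Rightarrow> nat" where
  "lit_var (Pos v) = v"
| "lit_var (Neg v) = v"

fun lit_val :: "(nat \<Rightarrow> bool) \<Rightarrow> literal \<Rightarrow> bool" where
  "lit_val \<sigma> (Pos v) = \<sigma> v"
| "lit_val \<sigma> (Neg v) = (\<not> \<sigma> v)"

type_synonym clause = "literal list"

text \<open>
  A formula \<open>(n, Cs)\<close> has the variables \<open>0, ..., n - 1\<close> and the constraints \<open>Cs\<close>, which may
  repeat. There is at least one constraint, so that the fraction of satisfied ones makes sense.
\<close>

type_synonym formula = "nat \<times> clause list"

definition nae_e3_formula :: "formula \<Rightarrow> bool" where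
  "nae_e3_formula \<phi> \<longleftrightarrow> snd \<phi> \<noteq> [] \<and>
     (\<forall>C \<in> set (snd \<phi>). length C = 3 \<and> distinct C \<and> (\<forall>l \<in> set C. lit_var l < fst \<phi>))"

definition nae_sat :: "(nat \<Rightarrow> bool) \<Rightarrow> clause \<Rightarrow> bool" where
  "nae_sat \<sigma> C \<longleftrightarrow> (\<exists>l \<in> set C. \<exists>l' \<in> set C. lit_val \<sigma> l \<noteq> lit_val \<sigma> l')"

definition sat_fraction :: "formula \<Rightarrow> (nat \<Rightarrow> bool) \<Rightarrow> real" where
  "sat_fraction \<phi> \<sigma> = real (length (filter (nae_sat \<sigma>) (snd \<phi>))) / real (length (snd \<phi>))"

text \<open>The range is finite, since every value is of the form \<open>k / m\<close> with \<open>k \<le> m\<close>.\<close>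

definition formula_val :: "formula \<Rightarrow> real" where
  "formula_val \<phi> = Max (range (sat_fraction \<phi>))"

fun enc_literal :: "literal \<Rightarrow> string" where
  "enc_literal (Pos v) = ''+'' @ enc_nat v @ '',''"
| "enc_literal (Neg v) = ''-'' @ enc_nat v @ '',''"

definition enc_formula :: "formula \<Rightarrow> string" where
  "enc_formula \<phi> = enc_nat (fst \<phi>) @ ''#'' @
     concat (map (\<lambda>C. concat (map enc_literal C) @ '';'') (snd \<phi>))"

definition nae_e3_sat :: "real \<Rightarrow> real \<Rightarrow> formula promise_problem" where
  "nae_e3_sat \<delta> \<epsilon> =
    \<lparr> instances = {\<phi>. nae_e3_formula \<phi>},
      encode = enc_formula,
      YES = {\<phi>. nae_e3_formula \<phi> \<and> formula_val \<phi> \<ge> \<epsilon>},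
      NO = {\<phi>. nae_e3_formula \<phi> \<and> formula_val \<phi> < \<delta>} \<rparr>"


section \<open>Linear discrepancy, covering radius and BinGapCRP\<close>

definition pnorm :: "real \<Rightarrow> real vec \<Rightarrow> real" where
  "pnorm p v = (\<Sum>i<dim_vec v. \<bar>v $ i\<bar> powr p) powr (1 / p)"

definition unit_cube :: "nat \<Rightarrow> real vec set" where
  "unit_cube n = {w \<in> carrier_vec n. \<forall>i<n. 0 \<le> w $ i \<and> w $ i \<le> 1}"

definition binary_vecs :: "nat \<Rightarrow> real vec set" where
  "binary_vecs n = {x \<in> carrier_vec n. \<forall>i<n. x $ i \<in> {0, 1}}"

definition integer_vecs :: "nat \<Rightarrow> real vec set" where
  "integer_vecs n = {x \<in> carrier_vec n. \<forall>i<n. x $ i \<in> \<int>}"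

text \<open>
  The outer maxima over the compact cube and the inner minima (over a finite set and over
  a coset of a lattice, respectively) are written as suprema and infima.
\<close>

definition lindisc :: "real \<Rightarrow> real mat \<Rightarrow> real" where
  "lindisc p B =
     (SUP w \<in> unit_cube (dim_col B). INF x \<in> binary_vecs (dim_col B). pnorm p (B *\<^sub>v (w - x)))"

text \<open>The covering radius of the lattice with basis \<open>B\<close>.\<close>

definition covering_radius :: "real \<Rightarrow> real mat \<Rightarrow> real" where
  "covering_radius p B =
     (SUP w \<in> unit_cube (dim_col B). INF x \<in> integer_vecs (dim_col B). pnorm p (B *\<^sub>v (w - x)))"

definition full_column_rank :: "real mat \<Rightarrow> bool" where
  "full_column_rank B \<longleftrightarrow> vec_space.rank (dim_row B) B = dim_col B"

text \<open>Bases in inputs have rational entries; \<open>real_mat\<close> views them as real matrices.\<close>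

abbreviation real_mat :: "rat mat \<Rightarrow> real mat" where
  "real_mat \<equiv> map_mat of_rat"

definition enc_mat :: "rat mat \<Rightarrow> string" where
  "enc_mat B = concat (map (\<lambda>i.
     concat (map (\<lambda>j. enc_rat (B $$ (i, j)) @ '','') [0..<dim_col B]) @ '';'') [0..<dim_row B])"

type_synonym crp_instance = "rat mat \<times> rexp"

definition crp_instances :: "real list \<Rightarrow> crp_instance set" where
  "crp_instances cs =
     {(B, e). 0 < dim_col B \<and> full_column_rank (real_mat B) \<and> 0 < rexp_val cs e}"

text \<open>
  \<open>\<gamma>\<close>-BinGapCRP in the \<open>p\<close>-norm, where radii are written with the constants \<open>cs\<close>.
\<close>

definition bin_gap_crp :: "real list \<Rightarrow> real \<Rightarrow> real \<Rightarrow> crp_instance promise_problem" where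
  "bin_gap_crp cs p \<gamma> =
    \<lparr> instances = crp_instances cs,
      encode = (\<lambda>(B, e). enc_mat B @ ''#'' @ enc_rexp e),
      YES = {(B, e) \<in> crp_instances cs. lindisc p (real_mat B) \<le> rexp_val cs e},
      NO = {(B, e) \<in> crp_instances cs. covering_radius p (real_mat B) > \<gamma> * rexp_val cs e} \<rparr>"

definition gap_factor :: "real \<Rightarrow> real \<Rightarrow> real \<Rightarrow> real" where
  "gap_factor \<delta> \<epsilon> p =
     ((\<delta> * (10 / 2 powr p) + (1 - \<delta>) * ((3/2) powr p + 9 / 2 powr p)) /
      (\<epsilon> * (4/3) powr p + (1 - \<epsilon>) * 2 powr p + 3 * (2 + (4/3) powr p))) powr (1 / p)"

end

theory Submission
  imports Defs
begin

text \<open>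
  A variable \<open>v\<close> that occurs in the formula gets three columns. For a displacement \<open>w - x\<close> with
  coordinates \<open>a, b, c\<close> in these columns, \<open>y = (a + b + c) / 3\<close> is the value of \<open>v\<close>. A clause
  gives the row of the signed sum of its three values, and every occurrence of a variable gives the
  rows \<open>-a + b + c\<close>, \<open>a - b + c\<close>, \<open>a + b - c\<close>.

  Every point of the cube can be rounded to a binary point such that \<open>y\<close> has a prescribed sign,
  \<open>\<bar>y\<bar> \<le> 2/3\<close>, and the gadget rows are bounded by 4/3, 1 and 1 in some order. With the signs of an
  assignment, a satisfied clause then costs at most 4/3 and an unsatisfied one at most 2. Conversely,
  at the point \<open>(1/2, ..., 1/2)\<close> all rows of the gadget are odd multiples of 1/2 for every integer
  vector, and either \<open>y = \<plusminus>1/2\<close> or some gadget row is at least 3/2, which pays for whatever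
  the clause row may save.

  The reduction is computed by a three-tape machine, obtained by compiling a while program. With the
  distinct variables listed on the work tape, an entry of the matrix only depends on comparisons of
  variable names, so the matrix can be written row by row in polynomial time.
\<close>

section \<open>While programs on three tapes\<close>

text \<open>With one column per variable, a displacement of prescribed sign can have absolute value
  up to 1, so a satisfied clause row could reach 2, more than the 3/2 of an unsatisfied one at the
  center. Averaging three columns leaves the freedom to stay within 2/3, and 4/3 < 3/2 makes the
  factor exceed 1 for large \<open>p\<close> when \<epsilon> = 1 and \<delta> < 1. The price is that
  the three columns of a variable may be rounded inconsistently, which the gadget rows have to
  punish.

  The covering radius admits all integer vectors, so the punishment must work far from the cube too.
  Repeating the gadget for every occurrence lets each clause pay for its own three literals, so both
  bounds are proved clause by clause. A clause owns ten rows. At the center and with consistent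
  columns, nine gadget rows are 1/2 in absolute value and the clause row is 1/2 or 3/2; this is the
  origin of 10/2^p and (3/2)^p + 9/2^p. Both costs are affine in the fraction of satisfied clauses,
  and the number of clauses cancels in the quotient.\<close>

definition zip_tape :: "string \<Rightarrow> string \<Rightarrow> tape" where
  "zip_tape l r = (word_on_tape (rev l @ r), int (length l))"

fun hd_opt :: "'a list \<Rightarrow> 'a option" where
  "hd_opt [] = None"
| "hd_opt (x # xs) = Some x"

lemma read_zip_tape [simp]: "read_tape (zip_tape l r) = hd_opt r"
  by (cases r) (auto simp: read_tape_def zip_tape_def word_on_tape_def nth_append)

lemma act_tape_stay [simp]: "act_tape (read_tape t, Stay) t = t"
  by (simp add: act_tape_def read_tape_def)

lemma act_tape_stay_zip [simp]: "act_tape (hd_opt r, Stay) (zip_tape l r) = zip_tape l r"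
  by (metis act_tape_stay read_zip_tape)

text \<open>Once the simplifier has evaluated \<open>hd_opt\<close> on an explicit list, the general
  rule no longer matches, so its two instances become rules of their own.\<close>

lemmas act_tape_stay_cases [simp] =
  act_tape_stay_zip[of "[]", simplified] act_tape_stay_zip[of "c # r" for c r, simplified]

lemma act_tape_right [simp]:
  "act_tape (Some c, MoveRight) (zip_tape l (c # r)) = zip_tape (c # l) r"
  by (auto simp: act_tape_def zip_tape_def word_on_tape_def nth_append)

lemma act_tape_left [simp]:
  "act_tape (hd_opt r, MoveLeft) (zip_tape (c # l) r) = zip_tape l (c # r)"
  by (cases r) (auto simp: act_tape_def zip_tape_def word_on_tape_def nth_append fun_eq_iff
      nth_Cons' nat_eq_iff)

lemmas act_tape_left_cases [simp] =
  act_tape_left[of "[]", simplified] act_tape_left[of "c # r" for c r, simplified]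

lemma act_tape_append [simp]:
  "act_tape (Some c, MoveRight) (zip_tape l []) = zip_tape (c # l) []"
  by (auto simp: act_tape_def zip_tape_def word_on_tape_def nth_append fun_eq_iff
      nth_Cons' nat_eq_iff)


datatype tape_op = R0 | L0 | R1 | L1 | Copy | Put char | Emit char

text \<open>
  A store \<open>(l, r, l', r', out)\<close> describes an input tape, a work tape and an output tape by the
  words to the left of the head (reversed) and from the head on; on the output tape the head stays
  at the right end. Operations that would leave the written part of a tape are undefined.
\<close>

type_synonym store = "string \<times> string \<times> string \<times> string \<times> string"

fun op_store :: "tape_op \<Rightarrow> store \<Rightarrow> store option" where
  "op_store R0 (l, c # r, l', r', out) = Some (c # l, r, l', r', out)"
| "op_store L0 (c # l, r, l', r', out) = Some (l, c # r, l', r', out)"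
| "op_store R1 (l, r, l', c # r', out) = Some (l, r, c # l', r', out)"
| "op_store L1 (l, r, c # l', r', out) = Some (l, r, l', c # r', out)"
| "op_store Copy (l, c # r, l', [], out) = Some (l, c # r, c # l', [], out)"
| "op_store (Put c) (l, r, l', [], out) = Some (l, r, c # l', [], out)"
| "op_store (Emit c) (l, r, l', r', out) = Some (l, r, l', r', c # out)"
| "op_store _ _ = None"

fun op_action :: "tape_op \<Rightarrow> char option list \<Rightarrow> (char option \<times> move) list" where
  "op_action R0 ss = [(ss ! 0, MoveRight), (ss ! 1, Stay), (ss ! 2, Stay)]"
| "op_action L0 ss = [(ss ! 0, MoveLeft), (ss ! 1, Stay), (ss ! 2, Stay)]"
| "op_action R1 ss = [(ss ! 0, Stay), (ss ! 1, MoveRight), (ss ! 2, Stay)]"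
| "op_action L1 ss = [(ss ! 0, Stay), (ss ! 1, MoveLeft), (ss ! 2, Stay)]"
| "op_action Copy ss = [(ss ! 0, Stay), (ss ! 0, MoveRight), (ss ! 2, Stay)]"
| "op_action (Put c) ss = [(ss ! 0, Stay), (Some c, MoveRight), (ss ! 2, Stay)]"
| "op_action (Emit c) ss = [(ss ! 0, Stay), (ss ! 1, Stay), (Some c, MoveRight)]"

definition idle :: "char option list \<Rightarrow> (char option \<times> move) list" where
  "idle ss = [(ss ! 0, Stay), (ss ! 1, Stay), (ss ! 2, Stay)]"

fun tapes :: "store \<Rightarrow> tape list" where
  "tapes (l, r, l', r', out) = [zip_tape l r, zip_tape l' r', zip_tape out []]"

type_synonym test = "char option \<Rightarrow> char option \<Rightarrow> bool"

fun holds :: "test \<Rightarrow> store \<Rightarrow> bool" where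
  "holds b (l, r, l', r', out) = b (hd_opt r) (hd_opt r')"

lemma holds_True [simp]: "holds (\<lambda>_ _. True) s"
  by (cases s) simp

lemma tapes_op_store:
  assumes "op_store a s = Some s'"
  shows "map2 act_tape (op_action a (map read_tape (tapes s))) (tapes s) = tapes s'"
  using assms by (induction a s rule: op_store.induct) auto

lemma tapes_idle: "map2 act_tape (idle (map read_tape (tapes s))) (tapes s) = tapes s"
  by (cases s) (simp add: idle_def)

lemma holds_tapes:
  "b (map read_tape (tapes s) ! 0) (map read_tape (tapes s) ! 1) = holds b s"
  by (cases s) simp

section \<open>A while language with time bounds\<close>

datatype cmd = Skip | Op tape_op | Seq cmd cmd (infixr \<open>;;\<close> 60) | Cond test cmd cmd | While test cmd

text \<open>The number is an upper bound for the running time.\<close>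

inductive exec :: "cmd \<Rightarrow> store \<Rightarrow> nat \<Rightarrow> store \<Rightarrow> bool" where
  exec_mono: "exec c s t s' \<Longrightarrow> t \<le> t' \<Longrightarrow> exec c s t' s'"
| exec_Skip: "exec Skip s 0 s"
| exec_Op: "op_store a s = Some s' \<Longrightarrow> exec (Op a) s 1 s'"
| exec_Seq: "exec c s t s' \<Longrightarrow> exec d s' t' s'' \<Longrightarrow> exec (c ;; d) s (t + t') s''"
| exec_If_True: "holds b s \<Longrightarrow> exec c s t s' \<Longrightarrow> exec (Cond b c d) s (t + 2) s'"
| exec_If_False: "\<not> holds b s \<Longrightarrow> exec d s t s' \<Longrightarrow> exec (Cond b c d) s (t + 2) s'"
| exec_While_False: "\<not> holds b s \<Longrightarrow> exec (While b c) s 1 s"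
| exec_While_True: "holds b s \<Longrightarrow> exec c s t s' \<Longrightarrow> exec (While b c) s' t' s'' \<Longrightarrow>
    exec (While b c) s (t + 2 + t') s''"

section \<open>Compilation to Turing machines\<close>

type_synonym instr = "char option list \<Rightarrow> nat \<times> (char option \<times> move) list"

fun code_size :: "cmd \<Rightarrow> nat" where
  "code_size Skip = 0"
| "code_size (Op a) = 1"
| "code_size (c ;; d) = code_size c + code_size d"
| "code_size (Cond b c d) = code_size c + code_size d + 2"
| "code_size (While b c) = code_size c + 2"

definition branch :: "test \<Rightarrow> nat \<Rightarrow> nat \<Rightarrow> instr" where
  "branch b i j = (\<lambda>ss. (if b (ss ! 0) (ss ! 1) then i else j, idle ss))"

text \<open>Addresses are absolute: \<open>i\<close> is the control state of the first instruction,
  and falling off the end of the whole program enters the halting state. An unconditional jump is a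
  \<open>branch\<close> on a true test, whose second target 0 is a dummy. Test and jump are the two
  extra steps that \<open>exec\<close> charges for a conditional and for each round of a
  loop.\<close>

fun compile :: "cmd \<Rightarrow> nat \<Rightarrow> instr list" where
  "compile Skip i = []"
| "compile (Op a) i = [\<lambda>ss. (i + 1, op_action a ss)]"
| "compile (c ;; d) i = compile c i @ compile d (i + code_size c)"
| "compile (Cond b c d) i =
     branch b (i + 1) (i + 2 + code_size c) # compile c (i + 1) @
     branch (\<lambda>_ _. True) (i + 2 + code_size c + code_size d) 0 # compile d (i + 2 + code_size c)"
| "compile (While b c) i =
     branch b (i + 1) (i + 2 + code_size c) # compile c (i + 1) @ [branch (\<lambda>_ _. True) i 0]"

lemma length_compile [simp]: "length (compile c i) = code_size c"
  by (induction c arbitrary: i) auto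

lemma compile_wf:
  assumes "f \<in> set (compile c i)"
  shows "fst (f ss) \<le> i + code_size c \<and> length (snd (f ss)) = 3"
  using assms
proof (induction c arbitrary: i)
  case (Op a)
  then show ?case by (cases a) auto
qed (fastforce simp: branch_def idle_def)+

definition machine :: "cmd \<Rightarrow> tm" where
  "machine c = \<lparr>num_tapes = 3, num_states = code_size c, delta = (\<lambda>q. compile c 0 ! q)\<rparr>"

lemma wf_tm_machine: "wf_tm (machine c)"
  unfolding wf_tm_def machine_def
  using compile_wf[of _ c 0] by (simp add: nth_mem)

lemma step_branch:
  assumes "compile c0 0 ! q = branch b i j" "q < code_size c0"
  shows "tm_step (machine c0) (q, tapes s) = (if holds b s then i else j, tapes s)"
  using assms tapes_idle[of s] holds_tapes[of b s]
  by (simp add: tm_step_def machine_def branch_def)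

lemma step_op:
  assumes "compile c0 0 ! q = (\<lambda>ss. (j, op_action a ss))" "q < code_size c0"
    and "op_store a s = Some s'"
  shows "tm_step (machine c0) (q, tapes s) = (j, tapes s')"
  using assms tapes_op_store[of a s s'] by (simp add: tm_step_def machine_def)

definition steps :: "cmd \<Rightarrow> config \<Rightarrow> nat \<Rightarrow> config \<Rightarrow> bool" where
  "steps c x t y \<longleftrightarrow> (\<exists>n\<le>t. (tm_step (machine c) ^^ n) x = y)"

lemma steps_refl: "steps c x 0 x"
  by (simp add: steps_def)

lemma steps_mono: "steps c x t y \<Longrightarrow> t \<le> t' \<Longrightarrow> steps c x t' y"
  unfolding steps_def using order_trans by blast

lemma steps_trans: "steps c x t y \<Longrightarrow> steps c y t' z \<Longrightarrow> steps c x (t + t') z"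
proof -
  assume "steps c x t y" "steps c y t' z"
  then obtain m n where "m \<le> t" "(tm_step (machine c) ^^ m) x = y"
    "n \<le> t'" "(tm_step (machine c) ^^ n) y = z"
    unfolding steps_def by blast
  then have "n + m \<le> t + t'" "(tm_step (machine c) ^^ (n + m)) x = z"
    by (auto simp: funpow_add)
  then show ?thesis unfolding steps_def by blast
qed

lemma steps_one: "tm_step (machine c) x = y \<Longrightarrow> steps c x 1 y"
  unfolding steps_def by (rule exI[of _ 1]) simp

text \<open>The induction needs the fragment \<open>c\<close> inside an arbitrary program
  \<open>c0\<close>, with code \<open>p\<close> before it and \<open>q\<close> after it; since
  addresses are absolute, its code must be the one compiled for position \<open>length p\<close>. As
  \<open>steps\<close> only bounds the number of steps, weakening a time bound is harmless.\<close>

lemma exec_steps: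
  assumes "exec c s t s'"
    and "compile c0 0 = p @ compile c (length p) @ q"
  shows "steps c0 (length p, tapes s) t (length p + code_size c, tapes s')"
  using assms
proof (induction arbitrary: p q rule: exec.induct)
  case (exec_mono c s t s' t')
  then show ?case using steps_mono by blast
next
  case (exec_Skip s)
  then show ?case by (simp add: steps_refl)
next
  case (exec_Op a s s')
  have "length (compile c0 0) = length (p @ compile (Op a) (length p) @ q)"
    using exec_Op.prems by (rule arg_cong)
  then have "length p < code_size c0"
    by simp
  with exec_Op show ?case
    by (intro steps_one) (subst step_op[where a = a and s' = s'], auto)
next
  case (exec_Seq c s t s' d t' s'')
  have "steps c0 (length p, tapes s) t (length p + code_size c, tapes s')"
    using exec_Seq.IH(1)[of p "compile d (length p + code_size c) @ q"] exec_Seq.prems by simp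
  moreover have "steps c0 (length p + code_size c, tapes s') t'
      (length p + code_size c + code_size d, tapes s'')"
    using exec_Seq.IH(2)[of "p @ compile c (length p)" q] exec_Seq.prems by simp
  ultimately show ?case by (auto dest: steps_trans simp: add.assoc)
next
  case (exec_If_True b s c t s' d)
  let ?j = "length p + 2 + code_size c"
  have len: "code_size c0 = length (p @ compile (Cond b c d) (length p) @ q)"
    using exec_If_True.prems by (metis length_compile)
  have "steps c0 (length p, tapes s) 1 (length p + 1, tapes s)"
    using exec_If_True.hyps exec_If_True.prems len
    by (intro steps_one) (subst step_branch[where b = b], auto)
  moreover have "steps c0 (length p + 1, tapes s) t (length p + 1 + code_size c, tapes s')"
    using exec_If_True.IH[of "p @ [branch b (length p + 1) ?j]"
        "branch (\<lambda>_ _. True) (?j + code_size d) 0 # compile d ?j @ q"] exec_If_True.prems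
    by simp
  moreover have "steps c0 (length p + 1 + code_size c, tapes s') 1 (?j + code_size d, tapes s')"
    using exec_If_True.prems len
    by (intro steps_one) (subst step_branch[where b = "\<lambda>_ _. True" and j = 0],
        auto simp: nth_append)
  ultimately have "steps c0 (length p, tapes s) (1 + t + 1) (?j + code_size d, tapes s')"
    by (meson steps_trans)
  then show ?case by (simp add: algebra_simps)
next
  case (exec_If_False b s d t s' c)
  let ?j = "length p + 2 + code_size c"
  have len: "code_size c0 = length (p @ compile (Cond b c d) (length p) @ q)"
    using exec_If_False.prems by (metis length_compile)
  have "steps c0 (length p, tapes s) 1 (?j, tapes s)"
    using exec_If_False.hyps exec_If_False.prems len
    by (intro steps_one) (subst step_branch[where b = b], auto)
  moreover have "steps c0 (?j, tapes s) t (?j + code_size d, tapes s')"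
    using exec_If_False.IH[of "p @ branch b (length p + 1) ?j # compile c (length p + 1) @
        [branch (\<lambda>_ _. True) (?j + code_size d) 0]" q] exec_If_False.prems
    by simp
  ultimately have "steps c0 (length p, tapes s) (1 + t) (?j + code_size d, tapes s')"
    by (meson steps_trans)
  then have "steps c0 (length p, tapes s) (t + 2) (?j + code_size d, tapes s')"
    by (rule steps_mono) simp
  then show ?case by (simp add: algebra_simps)
next
  case (exec_While_False b s c)
  have len: "code_size c0 = length (p @ compile (While b c) (length p) @ q)"
    using exec_While_False.prems by (metis length_compile)
  show ?case
    using exec_While_False len
    by (intro steps_one) (subst step_branch[where b = b], auto)
next
  case (exec_While_True b s c t s' t' s'')
  let ?j = "length p + 2 + code_size c"
  have len: "code_size c0 = length (p @ compile (While b c) (length p) @ q)"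
    using exec_While_True.prems by (metis length_compile)
  have "steps c0 (length p, tapes s) 1 (length p + 1, tapes s)"
    using exec_While_True.hyps exec_While_True.prems len
    by (intro steps_one) (subst step_branch[where b = b], auto)
  moreover have "steps c0 (length p + 1, tapes s) t (length p + 1 + code_size c, tapes s')"
    using exec_While_True.IH(1)[of "p @ [branch b (length p + 1) ?j]"
        "branch (\<lambda>_ _. True) (length p) 0 # q"] exec_While_True.prems
    by simp
  moreover have "steps c0 (length p + 1 + code_size c, tapes s') 1 (length p, tapes s')"
    using exec_While_True.prems len
    by (intro steps_one) (subst step_branch[where b = "\<lambda>_ _. True" and j = 0],
        auto simp: nth_append)
  \<comment> \<open>The final jump returns to the loop head, so the second induction hypothesis
    applies with the same surrounding code.\<close>
  moreover have "steps c0 (length p, tapes s') t' (?j, tapes s'')"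
    using exec_While_True.IH(2)[OF exec_While_True.prems] by (simp add: algebra_simps)
  ultimately have "steps c0 (length p, tapes s) (1 + t + 1 + t') (?j, tapes s'')"
    by (meson steps_trans)
  then show ?case by (simp add: algebra_simps)
qed

text \<open>The output tape keeps its word reversed to the left of the head and nothing to the
  right. Since \<open>zip_tape\<close> starts every word at cell 0, the tape holds exactly
  \<open>word_on_tape y\<close>.\<close>

lemma exec_computes_within:
  assumes "exec c ([], x, [], [], []) t (l, r, l', r', rev y)"
  shows "computes_within (machine c) x y t"
proof -
  have init: "init_config (machine c) x = (0, tapes ([], x, [], [], []))"
    by (simp add: init_config_def machine_def zip_tape_def numeral_2_eq_2)
  have "steps c (0, tapes ([], x, [], [], [])) t (code_size c, tapes (l, r, l', r', rev y))"
    using exec_steps[OF assms, of c "[]" "[]"] by simp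
  then obtain n where "n \<le> t"
    "(tm_step (machine c) ^^ n) (init_config (machine c) x) =
      (code_size c, tapes (l, r, l', r', rev y))"
    unfolding steps_def init by blast
  then show ?thesis
    unfolding computes_within_def
    by (intro exI[of _ n]) (simp add: machine_def zip_tape_def)
qed

section \<open>Moving along the tapes\<close>

abbreviation "comma \<equiv> CHR '',''"
abbreviation "semi \<equiv> CHR '';''"
abbreviation "hash \<equiv> CHR ''#''"

lemma exec_Op': "op_store a s = Some s' \<Longrightarrow> 1 \<le> t \<Longrightarrow> exec (Op a) s t s'"
  by (rule exec_mono[OF exec_Op])

lemma exec_If:
  assumes "holds b s \<Longrightarrow> exec c s t s'" and "\<not> holds b s \<Longrightarrow> exec d s t s'"
  shows "exec (Cond b c d) s (t + 2) s'"
  using assms exec_If_True exec_If_False by blast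

lemma exec_cong: "exec c s t s' \<Longrightarrow> s = r \<Longrightarrow> t \<le> t' \<Longrightarrow> s' = r' \<Longrightarrow> exec c r t' r'"
  using exec_mono by blast

lemma exec_skip_R0:
  assumes "\<forall>c\<in>set u. p (Some c)" "\<not> p (hd_opt r)"
  shows "exec (While (\<lambda>x _. p x) (Op R0)) (l, u @ r, l', r', out) (3 * length u + 1)
    (rev u @ l, r, l', r', out)"
  using assms
proof (induction u arbitrary: l)
  case Nil
  then show ?case using exec_While_False by simp
next
  case (Cons c u)
  have "exec (Op R0) (l, (c # u) @ r, l', r', out) 1 (c # l, u @ r, l', r', out)"
    by (rule exec_Op) simp
  from exec_While_True[OF _ this Cons.IH] show ?case
    by (rule exec_cong) (use Cons.prems in auto)
qed

lemma exec_skip_R1: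
  assumes "\<forall>c\<in>set u. p (Some c)" "\<not> p (hd_opt r')"
  shows "exec (While (\<lambda>_ y. p y) (Op R1)) (l, r, l', u @ r', out) (3 * length u + 1)
    (l, r, rev u @ l', r', out)"
  using assms
proof (induction u arbitrary: l')
  case Nil
  then show ?case using exec_While_False by simp
next
  case (Cons c u)
  have "exec (Op R1) (l, r, l', (c # u) @ r', out) 1 (l, r, c # l', u @ r', out)"
    by (rule exec_Op) simp
  from exec_While_True[OF _ this Cons.IH] show ?case
    by (rule exec_cong) (use Cons.prems in auto)
qed

text \<open>The loop stops on the marker \<open>k\<close>, and the last move steps off it again. The
  test precedes the first move, so the symbol under the head at the start must pass it as well. The
  walk consumes \<open>u\<close> from its end, hence the reverse induction.\<close>

lemma exec_skip_L0:
  assumes "p (hd_opt r)" "\<forall>c\<in>set u. p (Some c)" "\<not> p (Some k)"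
  shows "exec (While (\<lambda>x _. p x) (Op L0) ;; Op R0) (rev u @ k # l, r, l', r', out)
    (3 * length u + 5) (k # l, u @ r, l', r', out)"
proof -
  have "exec (While (\<lambda>x _. p x) (Op L0)) (rev u @ k # l, r, l', r', out)
    (3 * length u + 4) (l, k # u @ r, l', r', out)"
    using assms
  proof (induction u arbitrary: r rule: rev_induct)
    case Nil
    have "exec (Op L0) (k # l, r, l', r', out) 1 (l, k # r, l', r', out)"
      by (rule exec_Op) simp
    from exec_While_True[OF _ this exec_While_False] show ?case
      by (rule exec_cong) (use Nil.prems in auto)
  next
    case (snoc c u)
    have "exec (Op L0) (c # rev u @ k # l, r, l', r', out) 1 (rev u @ k # l, c # r, l', r', out)"
      by (rule exec_Op) simp
    from exec_While_True[OF _ this snoc.IH] show ?case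
      by (rule exec_cong) (use snoc.prems in auto)
  qed
  from exec_Seq[OF this exec_Op] show ?thesis
    by (rule exec_mono) auto
qed

lemma exec_skip_L1:
  assumes "p (hd_opt r')" "\<forall>c\<in>set u. p (Some c)" "\<not> p (Some k)"
  shows "exec (While (\<lambda>_ y. p y) (Op L1) ;; Op R1) (l, r, rev u @ k # l', r', out)
    (3 * length u + 5) (l, r, k # l', u @ r', out)"
proof -
  have "exec (While (\<lambda>_ y. p y) (Op L1)) (l, r, rev u @ k # l', r', out)
    (3 * length u + 4) (l, r, l', k # u @ r', out)"
    using assms
  proof (induction u arbitrary: r' rule: rev_induct)
    case Nil
    have "exec (Op L1) (l, r, k # l', r', out) 1 (l, r, l', k # r', out)"
      by (rule exec_Op) simp
    from exec_While_True[OF _ this exec_While_False] show ?case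
      by (rule exec_cong) (use Nil.prems in auto)
  next
    case (snoc c u)
    have "exec (Op L1) (l, r, c # rev u @ k # l', r', out) 1 (l, r, rev u @ k # l', c # r', out)"
      by (rule exec_Op) simp
    from exec_While_True[OF _ this snoc.IH] show ?case
      by (rule exec_cong) (use snoc.prems in auto)
  qed
  from exec_Seq[OF this exec_Op] show ?thesis
    by (rule exec_mono) auto
qed

fun emits :: "string \<Rightarrow> cmd" where
  "emits [] = Skip"
| "emits (c # w) = Op (Emit c) ;; emits w"

lemma exec_emits: "exec (emits w) (l, r, l', r', out) (length w) (l, r, l', r', rev w @ out)"
proof (induction w arbitrary: out)
  case Nil
  then show ?case by (simp add: exec_Skip)
next
  case (Cons c w)
  have "exec (Op (Emit c)) (l, r, l', r', out) 1 (l, r, l', r', c # out)"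
    by (simp add: exec_Op')
  from exec_Seq[OF this Cons.IH] show ?case by simp
qed


section \<open>Comparing variable names\<close>

definition digits :: "char set" where
  "digits = {CHR ''0'', CHR ''1''}"

lemma special_not_digits [simp]:
  "comma \<notin> digits" "semi \<notin> digits" "hash \<notin> digits" "CHR ''+'' \<notin> digits" "CHR ''-'' \<notin> digits"
  by (auto simp: digits_def)

lemma enc_nat_digits: "set (enc_nat n) \<subseteq> digits"
proof (induction n rule: enc_nat.induct)
  case (1 n)
  then show ?case by (subst enc_nat.simps) (auto simp: digits_def)
qed

lemma enc_nat_neq_Nil [simp]: "enc_nat n \<noteq> []"
  by (subst enc_nat.simps) auto

lemma enc_nat_inject [simp]: "enc_nat m = enc_nat n \<longleftrightarrow> m = n"
proof
  show "enc_nat m = enc_nat n \<Longrightarrow> m = n"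
  proof (induction m arbitrary: n rule: enc_nat.induct)
    case (1 m)
    let ?pre = "\<lambda>k::nat. if k < 2 then [] else enc_nat (k div 2)"
    let ?bit = "\<lambda>k::nat. if even k then ''0'' else ''1''"
    have "?pre m @ ?bit m = ?pre n @ ?bit n"
      using "1.prems" enc_nat.simps by metis
    then have pre: "?pre m = ?pre n" and bit: "even m = even n"
      by (auto split: if_splits)
    show ?case
    proof (cases "m < 2")
      case True
      then have "n < 2" using pre enc_nat_neq_Nil by (metis (full_types))
      then show ?thesis using True bit by (auto simp: less_2_cases_iff)
    next
      case False
      then have "\<not> n < 2" using pre by (auto split: if_splits)
      then have "m div 2 = n div 2" using False pre "1.IH" by auto
      then show ?thesis using bit by (metis dvd_mult_div_cancel odd_two_times_div_two_succ)
    qed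
  qed
qed simp

lemma hd_opt_digits_neq_comma:
  assumes "set s \<subseteq> digits"
  shows "hd_opt (s @ comma # x) = Some comma \<longleftrightarrow> s = []"
  using assms by (cases s) auto

definition compare :: cmd where
  "compare = While (\<lambda>x y. x = y \<and> x \<noteq> Some comma) (Op R0 ;; Op R1)"

definition both_commas :: test where
  "both_commas = (\<lambda>x y. x = Some comma \<and> y = Some comma)"

text \<open>The word \<open>a\<close> is the common prefix, and \<open>s\<close>, \<open>s'\<close>
  are the unread rests. A comma is not a digit, so both heads stand on commas exactly if both names
  are exhausted, that is, equal.\<close>

lemma exec_compare:
  assumes "set u \<subseteq> digits" "set v \<subseteq> digits"
  obtains a s s' where "u = a @ s" "v = a @ s'" "s = [] \<and> s' = [] \<longleftrightarrow> u = v"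
    "exec compare (l, u @ comma # x, l', v @ comma # y, out) (4 * length u + 1)
      (rev a @ l, s @ comma # x, rev a @ l', s' @ comma # y, out)"
proof -
  let ?E = "\<lambda>u v l l' a s s'. exec compare (l, u @ comma # x, l', v @ comma # y, out)
    (4 * length u + 1) (rev a @ l, s @ comma # x, rev a @ l', s' @ comma # y, out)"
  have stop: "?E u v l l' [] u v"
    if "\<not> (hd_opt (u @ comma # x) = hd_opt (v @ comma # y) \<and> hd_opt (u @ comma # x) \<noteq> Some comma)"
    for u v l l'
    unfolding compare_def by (rule exec_cong[OF exec_While_False]) (use that in auto)
  have "\<exists>a s s'. u = a @ s \<and> v = a @ s' \<and> (s = [] \<and> s' = [] \<longleftrightarrow> u = v) \<and> ?E u v l l' a s s'"
    using assms
  proof (induction u arbitrary: v l l')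
    case Nil
    have "?E [] v l l' [] [] v" by (rule stop) simp
    then show ?case by (intro exI[of _ "[]"] exI[of _ v]) auto
  next
    case (Cons c u)
    show ?case
    proof (cases "v \<noteq> [] \<and> hd v = c")
      case False
      then have "?E (c # u) v l l' [] (c # u) v"
        using Cons.prems by (intro stop) (cases v; auto)
      moreover have "c # u \<noteq> v" using False by auto
      ultimately show ?thesis by (intro exI[of _ "[]"] exI[of _ "c # u"] exI[of _ v]) simp
    next
      case True
      then obtain w where v: "v = c # w" by (cases v) auto
      have "set u \<subseteq> digits" "set w \<subseteq> digits" using Cons.prems v by auto
      from Cons.IH[OF this, of "c # l" "c # l'"]
      obtain a s s' where IH: "u = a @ s" "w = a @ s'" "s = [] \<and> s' = [] \<longleftrightarrow> u = w"
        "?E u w (c # l) (c # l') a s s'" by blast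
      have "exec (Op R0 ;; Op R1) (l, (c # u) @ comma # x, l', v @ comma # y, out) (1 + 1)
          (c # l, u @ comma # x, c # l', w @ comma # y, out)"
        unfolding v by (rule exec_Seq; rule exec_Op) auto
      from exec_While_True[OF _ this IH(4)[unfolded compare_def]]
      have "?E (c # u) v l l' (c # a) s s'"
        unfolding compare_def by (rule exec_cong) (use Cons.prems v in auto)
      then show ?thesis using IH v by (intro exI[of _ "c # a"] exI[of _ s] exI[of _ s']) simp
    qed
  qed
  then show ?thesis using that by blast
qed

definition restore0 :: cmd where
  "restore0 = While (\<lambda>x _. x \<noteq> Some CHR ''+'' \<and> x \<noteq> Some CHR ''-'') (Op L0) ;; Op R0"

definition skip0 :: cmd where
  "skip0 = While (\<lambda>x _. x \<noteq> Some comma) (Op R0) ;; Op R0"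

definition skip1 :: cmd where
  "skip1 = While (\<lambda>_ y. y \<noteq> Some comma) (Op R1) ;; Op R1"

definition rewind0 :: cmd where
  "rewind0 = While (\<lambda>x _. x \<noteq> Some hash) (Op L0) ;; Op R0"

definition rewind1 :: cmd where
  "rewind1 = While (\<lambda>_ y. y \<noteq> Some hash) (Op L1) ;; Op R1"

lemma exec_restore0:
  assumes "set a \<subseteq> digits" "set s \<subseteq> digits" "g = CHR ''+'' \<or> g = CHR ''-''" "length a \<le> N"
  shows "exec restore0 (rev a @ g # l, s @ comma # x, l', r', out) (3 * N + 5)
    (g # l, a @ s @ comma # x, l', r', out)"
  unfolding restore0_def
  by (rule exec_mono[OF exec_skip_L0[where p = "\<lambda>x. x \<noteq> Some CHR ''+'' \<and> x \<noteq> Some CHR ''-''"]])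
    (use assms in \<open>cases s; auto simp: digits_def\<close>)+

lemma exec_skip0:
  assumes "set s \<subseteq> digits" "length s \<le> N"
  shows "exec skip0 (l, s @ comma # x, l', r', out) (3 * N + 2)
    (comma # rev s @ l, x, l', r', out)"
  unfolding skip0_def
  by (rule exec_mono[OF exec_Seq[OF exec_skip_R0[where p = "\<lambda>x. x \<noteq> Some comma"] exec_Op]])
    (use assms in \<open>auto simp: digits_def\<close>)

lemma exec_skip1:
  assumes "set s \<subseteq> digits" "length s \<le> N"
  shows "exec skip1 (l, r, l', s @ comma # x, out) (3 * N + 2)
    (l, r, comma # rev s @ l', x, out)"
  unfolding skip1_def
  by (rule exec_mono[OF exec_Seq[OF exec_skip_R1[where p = "\<lambda>x. x \<noteq> Some comma"] exec_Op]])
    (use assms in \<open>auto simp: digits_def\<close>)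

lemma exec_rewind0:
  assumes "hash \<notin> set u" "hash \<notin> set r"
  shows "exec rewind0 (rev u @ hash # l, r, l', r', out) (3 * length u + 5)
    (hash # l, u @ r, l', r', out)"
  unfolding rewind0_def
  by (rule exec_mono[OF exec_skip_L0[where p = "\<lambda>x. x \<noteq> Some hash"]])
    (use assms in \<open>cases r; auto\<close>)+

lemma exec_rewind1:
  assumes "hash \<notin> set u" "hash \<notin> set r'" "length u \<le> N"
  shows "exec rewind1 (l, r, rev u @ hash # l', r', out) (3 * N + 5)
    (l, r, hash # l', u @ r', out)"
  unfolding rewind1_def
  by (rule exec_mono[OF exec_skip_L1[where p = "\<lambda>x. x \<noteq> Some hash"]])
    (use assms in \<open>cases r'; auto\<close>)+

section \<open>Collecting the variables\<close>

definition enc_var :: "nat \<Rightarrow> string" where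
  "enc_var v = enc_nat v @ [comma]"

definition enc_vars :: "nat list \<Rightarrow> string" where
  "enc_vars vs = concat (map enc_var vs)"

lemma enc_vars_simps [simp]:
  "enc_vars [] = []"
  "enc_vars (v # vs) = enc_nat v @ comma # enc_vars vs"
  "enc_vars (vs @ ws) = enc_vars vs @ enc_vars ws"
  by (auto simp: enc_vars_def enc_var_def)

lemma enc_vars_chars: "set (enc_vars vs) \<subseteq> insert comma digits"
  by (induction vs) (use enc_nat_digits in auto)

lemma hash_enc_vars [simp]: "hash \<notin> set (enc_vars vs)"
  using enc_vars_chars[of vs] by auto

lemma length_enc_vars:
  assumes "\<forall>v\<in>set vs. length (enc_nat v) \<le> N" "length vs \<le> M"
  shows "length (enc_vars vs) \<le> M * (N + 1)"
proof -
  have "length (enc_vars vs) \<le> length vs * (N + 1)"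
    using assms(1) by (induction vs) auto
  also have "\<dots> \<le> M * (N + 1)"
    using assms(2) by (rule mult_le_mono1)
  finally show ?thesis .
qed

lemma hd_opt_enc_nat: "hd_opt (enc_nat v @ x) \<in> Some ` digits"
  using enc_nat_digits[of v] by (cases "enc_nat v") (auto simp: enc_nat_neq_Nil)

text \<open>The head of the input tape is on a comma afterwards iff the variable was found.\<close>

definition search :: cmd where
  "search = While (\<lambda>x y. x \<noteq> Some comma \<and> y \<noteq> None)
     (compare ;; Cond both_commas Skip (restore0 ;; skip1))"

text \<open>After a mismatch the input head returns to the start of the name and the work head
  passes to the next entry. The list itself is never changed; where the work head stops matters only
  in case of failure, when \<open>r1 = []\<close> says that it is at the end, ready for
  appending.\<close>

lemma exec_search:
  assumes "g = CHR ''+'' \<or> g = CHR ''-''"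
    and "length (enc_nat u) \<le> N" "\<forall>v\<in>set vs. length (enc_nat v) \<le> N"
  shows "\<exists>l1 r1. rev l1 @ r1 = rev l' @ enc_vars vs \<and> (u \<notin> set vs \<longrightarrow> r1 = []) \<and>
    exec search (g # l, enc_nat u @ comma # x, l', enc_vars vs, out)
      (length vs * (10 * N + 15) + 1)
      (if u \<in> set vs then (rev (enc_nat u) @ g # l, comma # x, l1, r1, out)
       else (g # l, enc_nat u @ comma # x, l1, r1, out))"
  using assms(3)
proof (induction vs arbitrary: l')
  case Nil
  have "exec search (g # l, enc_nat u @ comma # x, l', [], out) 1
      (g # l, enc_nat u @ comma # x, l', [], out)"
    unfolding search_def by (rule exec_While_False) simp
  then show ?case by (intro exI[of _ l'] exI[of _ "[]"]) simp
next
  case (Cons v vs)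
  let ?s = "(g # l, enc_nat u @ comma # x, l', enc_vars (v # vs), out)"
  let ?b = "\<lambda>x y. x \<noteq> Some comma \<and> y \<noteq> None"
  have go: "holds ?b ?s"
    using hd_opt_enc_nat[of u "comma # x"] hd_opt_enc_nat[of v] by (auto simp: digits_def)
  obtain a s s' where as: "enc_nat u = a @ s" "enc_nat v = a @ s'"
    "s = [] \<and> s' = [] \<longleftrightarrow> enc_nat u = enc_nat v"
    and cmp: "exec compare ?s (4 * length (enc_nat u) + 1)
      (rev a @ g # l, s @ comma # x, rev a @ l', s' @ comma # enc_vars vs, out)"
    using exec_compare[OF enc_nat_digits enc_nat_digits,
        of u v "g # l" x l' "enc_vars vs" out thesis]
    unfolding enc_vars_simps by blast
  have dig: "set a \<subseteq> digits" "set s \<subseteq> digits" "set s' \<subseteq> digits"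
    using enc_nat_digits[of u] enc_nat_digits[of v] as by auto
  have test: "holds both_commas (rev a @ g # l, s @ comma # x, rev a @ l', s' @ comma # enc_vars vs, out)
      \<longleftrightarrow> u = v"
    using as(3) dig by (simp add: both_commas_def hd_opt_digits_neq_comma)
  have lens: "length a \<le> N" "length s' \<le> N" "length (enc_nat u) \<le> N"
    using as assms(2) Cons.prems by auto
  show ?case
  proof (cases "u = v")
    case True
    then have *: "s = []" "s' = []" "a = enc_nat u" using as by auto
    have "exec (compare ;; Cond both_commas Skip (restore0 ;; skip1)) ?s (4 * length (enc_nat u) + 1 + (0 + 2))
      (rev a @ g # l, s @ comma # x, rev a @ l', s' @ comma # enc_vars vs, out)"
      using test True by (intro exec_Seq[OF cmp] exec_If_True exec_Skip) auto
    from exec_While_True[OF go this exec_While_False]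
    have "exec search ?s (length (v # vs) * (10 * N + 15) + 1)
      (rev (enc_nat u) @ g # l, comma # x, rev (enc_nat u) @ l', comma # enc_vars vs, out)"
      unfolding search_def by (rule exec_cong) (use * lens in auto)
    then show ?thesis
      using True by (intro exI[of _ "rev (enc_nat u) @ l'"] exI[of _ "comma # enc_vars vs"]) simp
  next
    case False
    let ?s' = "(g # l, enc_nat u @ comma # x, comma # rev (enc_nat v) @ l', enc_vars vs, out)"
    have "exec (restore0 ;; skip1)
        (rev a @ g # l, s @ comma # x, rev a @ l', s' @ comma # enc_vars vs, out)
        ((3 * N + 5) + (3 * N + 2)) ?s'"
      by (rule exec_cong[OF exec_Seq[OF exec_restore0 exec_skip1]])
        (use dig as lens assms(1) in auto)
    then have "exec (compare ;; Cond both_commas Skip (restore0 ;; skip1)) ?s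
        (4 * length (enc_nat u) + 1 + ((3 * N + 5) + (3 * N + 2) + 2)) ?s'"
      using test False by (intro exec_Seq[OF cmp] exec_If_False) auto
    note body = exec_While_True[OF go this]
    obtain l1 r1 where IH: "rev l1 @ r1 = rev (comma # rev (enc_nat v) @ l') @ enc_vars vs"
      "u \<notin> set vs \<longrightarrow> r1 = []"
      "exec search ?s' (length vs * (10 * N + 15) + 1)
        (if u \<in> set vs then (rev (enc_nat u) @ g # l, comma # x, l1, r1, out)
         else (g # l, enc_nat u @ comma # x, l1, r1, out))"
      using Cons.IH[of "comma # rev (enc_nat v) @ l'"] Cons.prems by auto
    have "exec search ?s (length (v # vs) * (10 * N + 15) + 1)
        (if u \<in> set vs then (rev (enc_nat u) @ g # l, comma # x, l1, r1, out)
         else (g # l, enc_nat u @ comma # x, l1, r1, out))"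
      unfolding search_def
      by (rule exec_cong[OF body[OF IH(3)[unfolded search_def]]])
        (use lens in \<open>auto simp: algebra_simps\<close>)
    then show ?thesis using IH False by (intro exI[of _ l1] exI[of _ r1]) auto
  qed
qed

definition add_var :: "nat list \<Rightarrow> nat \<Rightarrow> nat list" where
  "add_var vs v = (if v \<in> set vs then vs else vs @ [v])"

text \<open>Between calls the work head rests at the right end of the list, because
  \<open>Copy\<close> and \<open>Put\<close> can only append. The list is rewound for the search,
  and both branches restore this position.\<close>

definition insert_var :: cmd where
  "insert_var = Op R0 ;; rewind1 ;; search ;;
     Cond (\<lambda>x _. x = Some comma) (While (\<lambda>_ y. y \<noteq> None) (Op R1))
       (While (\<lambda>x _. x \<noteq> Some comma) (Op Copy ;; Op R0) ;; Op (Put comma)) ;;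
     Op R0"

lemma exec_copy:
  assumes "set u \<subseteq> digits"
  shows "exec (While (\<lambda>x _. x \<noteq> Some comma) (Op Copy ;; Op R0)) (l, u @ comma # x, l', [], out)
    (4 * length u + 1) (rev u @ l, comma # x, rev u @ l', [], out)"
  using assms
proof (induction u arbitrary: l l')
  case Nil
  show ?case by (rule exec_cong[OF exec_While_False]) auto
next
  case (Cons c u)
  have "exec (Op Copy ;; Op R0) (l, (c # u) @ comma # x, l', [], out) (1 + 1)
      (c # l, u @ comma # x, c # l', [], out)"
    by (rule exec_Seq; rule exec_Op) auto
  from exec_While_True[OF _ this Cons.IH] show ?case
    by (rule exec_cong) (use Cons.prems in auto)
qed

lemma exec_insert_var:
  assumes g: "g = CHR ''+'' \<or> g = CHR ''-''"
    and u: "length (enc_nat u) \<le> N" and vs: "\<forall>v\<in>set vs. length (enc_nat v) \<le> N" "length vs \<le> M"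
  shows "exec insert_var (l, g # enc_nat u @ comma # x, rev (hash # enc_vars vs), [], out)
    (25 * (N + 1) * (M + 1))
    (comma # rev (enc_nat u) @ g # l, x, rev (hash # enc_vars (add_var vs u)), [], out)"
proof -
  have 1: "exec (Op R0) (l, g # enc_nat u @ comma # x, rev (hash # enc_vars vs), [], out) 1
    (g # l, enc_nat u @ comma # x, rev (hash # enc_vars vs), [], out)"
    by (rule exec_Op) simp
  have len: "length (enc_vars vs) \<le> M * (N + 1)"
    using length_enc_vars vs by blast
  have 2: "exec rewind1 (g # l, enc_nat u @ comma # x, rev (hash # enc_vars vs), [], out)
    (3 * (M * (N + 1)) + 5) (g # l, enc_nat u @ comma # x, [hash], enc_vars vs, out)"
    by (rule exec_cong[OF exec_rewind1[where u = "enc_vars vs"]]) (use len in auto)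
  obtain l1 r1 where lr: "rev l1 @ r1 = hash # enc_vars vs" "u \<notin> set vs \<longrightarrow> r1 = []"
    and 3: "exec search (g # l, enc_nat u @ comma # x, [hash], enc_vars vs, out)
      (length vs * (10 * N + 15) + 1)
      (if u \<in> set vs then (rev (enc_nat u) @ g # l, comma # x, l1, r1, out)
       else (g # l, enc_nat u @ comma # x, l1, r1, out))"
    using exec_search[OF g u vs(1), of "[hash]" l x out] by auto
  have len': "length r1 \<le> M * (N + 1) + 1"
  proof -
    have "length r1 \<le> length (rev l1 @ r1)" by simp
    with lr len show ?thesis by simp
  qed
  have 4: "exec (Cond (\<lambda>x _. x = Some comma) (While (\<lambda>_ y. y \<noteq> None) (Op R1))
       (While (\<lambda>x _. x \<noteq> Some comma) (Op Copy ;; Op R0) ;; Op (Put comma)))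
      (if u \<in> set vs then (rev (enc_nat u) @ g # l, comma # x, l1, r1, out)
       else (g # l, enc_nat u @ comma # x, l1, r1, out))
      (3 * (M * (N + 1) + 1) + 4 * N + 2 + 2)
      (rev (enc_nat u) @ g # l, comma # x, rev (hash # enc_vars (add_var vs u)), [], out)"
  proof (cases "u \<in> set vs")
    case True
    have "rev r1 @ l1 = rev (hash # enc_vars (add_var vs u))"
      using True lr(1) by (metis add_var_def rev_append rev_rev_ident)
    then show ?thesis
      using exec_skip_R1[of r1 "\<lambda>y. y \<noteq> None" "[]" "rev (enc_nat u) @ g # l" "comma # x" l1 out] True len'
      by (intro exec_If_True) (auto elim!: exec_cong)
  next
    case False
    then have l1: "l1 = rev (hash # enc_vars vs)" "r1 = []"
      using lr by (metis append_Nil2 rev_rev_ident)+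
    have "exec (While (\<lambda>x _. x \<noteq> Some comma) (Op Copy ;; Op R0) ;; Op (Put comma))
      (g # l, enc_nat u @ comma # x, l1, r1, out) (4 * length (enc_nat u) + 1 + 1)
      (rev (enc_nat u) @ g # l, comma # x, rev (hash # enc_vars (add_var vs u)), [], out)"
      unfolding l1
      by (rule exec_Seq[OF exec_copy exec_Op]) (use False enc_nat_digits in \<open>auto simp: add_var_def\<close>)
    then show ?thesis
      using False hd_opt_enc_nat[of u "comma # x"] u
      by (intro exec_If_False) (auto simp: digits_def elim!: exec_cong)
  qed
  have 5: "exec (Op R0) (rev (enc_nat u) @ g # l, comma # x, rev (hash # enc_vars (add_var vs u)), [], out)
    1 (comma # rev (enc_nat u) @ g # l, x, rev (hash # enc_vars (add_var vs u)), [], out)"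
    by (rule exec_Op) simp
  have "length vs * (10 * N + 15) \<le> M * (10 * N + 15)"
    using vs(2) by (rule mult_le_mono1)
  then show ?thesis
    unfolding insert_var_def
    by (intro exec_mono[OF exec_Seq[OF 1 exec_Seq[OF 2 exec_Seq[OF 3 exec_Seq[OF 4 5]]]]])
      (simp add: algebra_simps)
qed

fun sign_char :: "literal \<Rightarrow> char" where
  "sign_char (Pos v) = CHR ''+''"
| "sign_char (Neg v) = CHR ''-''"

lemma sign_char_cases: "sign_char l = CHR ''+'' \<or> sign_char l = CHR ''-''"
  by (cases l) auto

lemma enc_literal_eq: "enc_literal l = sign_char l # enc_nat (lit_var l) @ [comma]"
  by (cases l) auto

definition enc_clause :: "clause \<Rightarrow> string" where
  "enc_clause C = concat (map enc_literal C) @ [semi]"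

definition enc_body :: "clause list \<Rightarrow> string" where
  "enc_body Cs = concat (map enc_clause Cs)"

lemma enc_body_simps [simp]:
  "enc_body [] = []"
  "enc_body (C # Cs) = concat (map enc_literal C) @ semi # enc_body Cs"
  by (auto simp: enc_body_def enc_clause_def)

lemma enc_literal_chars: "set (enc_literal l) \<subseteq> {CHR ''+'', CHR ''-'', comma} \<union> digits"
  using enc_nat_digits[of "lit_var l"] sign_char_cases[of l] by (auto simp: enc_literal_eq)

lemma hash_semi_literals [simp]:
  "hash \<notin> set (concat (map enc_literal C))" "semi \<notin> set (concat (map enc_literal C))"
  using enc_literal_chars by (fastforce simp: digits_def)+

lemma hash_enc_body [simp]: "hash \<notin> set (enc_body Cs)"
  using hash_semi_literals(1) by (induction Cs) (auto simp del: set_concat)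

lemma hd_opt_eq_None: "hd_opt x = None \<longleftrightarrow> x = []"
  by (cases x) auto

lemma hd_opt_append_Cons [simp]: "\<exists>y. hd_opt (x @ a # z) = Some y"
  by (cases x) auto

definition collect :: cmd where
  "collect = While (\<lambda>x _. x \<noteq> None)
     (While (\<lambda>x _. x \<noteq> Some semi) insert_var ;; Op R0)"

definition clause_vars :: "clause list \<Rightarrow> nat list" where
  "clause_vars Cs = map lit_var (concat Cs)"

lemma clause_vars_simps [simp]:
  "clause_vars [] = []"
  "clause_vars (C # Cs) = map lit_var C @ clause_vars Cs"
  by (auto simp: clause_vars_def)

lemma length_add_var: "length (add_var vs v) \<le> length vs + 1"
  by (simp add: add_var_def)

lemma set_add_var [simp]: "set (add_var vs v) = insert v (set vs)"
  by (auto simp: add_var_def)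

lemma length_foldl_add_var: "length (foldl add_var vs us) \<le> length vs + length us"
proof (induction us arbitrary: vs)
  case (Cons u us)
  show ?case using Cons.IH[of "add_var vs u"] length_add_var[of vs u] by simp
qed simp

lemma set_foldl_add_var [simp]: "set (foldl add_var vs us) = set vs \<union> set us"
  by (induction us arbitrary: vs) auto

lemma distinct_foldl_add_var: "distinct vs \<Longrightarrow> distinct (foldl add_var vs us)"
  by (induction us arbitrary: vs) (auto simp: add_var_def)

text \<open>The bound \<open>M\<close> counts the listed variables together with those still to
  come. This sum does not increase in the loop, as \<open>add_var\<close> lengthens the list by at
  most one, so one time bound serves all rounds.\<close>

lemma exec_insert_vars:
  assumes "\<forall>v\<in>set vs \<union> lit_var ` set C. length (enc_nat v) \<le> N" "length vs + length C \<le> M"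
  shows "exec (While (\<lambda>x _. x \<noteq> Some semi) insert_var)
    (l, concat (map enc_literal C) @ semi # x, rev (hash # enc_vars vs), [], out)
    (length C * (25 * (N + 1) * (M + 1) + 2) + 1)
    (rev (concat (map enc_literal C)) @ l, semi # x,
     rev (hash # enc_vars (foldl add_var vs (map lit_var C))), [], out)"
  using assms
proof (induction C arbitrary: vs l)
  case Nil
  show ?case by (rule exec_cong[OF exec_While_False]) auto
next
  case (Cons k C)
  let ?x = "concat (map enc_literal C) @ semi # x"
  have "exec insert_var (l, sign_char k # enc_nat (lit_var k) @ comma # ?x, rev (hash # enc_vars vs), [], out)
    (25 * (N + 1) * (M + 1))
    (comma # rev (enc_nat (lit_var k)) @ sign_char k # l, ?x,
     rev (hash # enc_vars (add_var vs (lit_var k))), [], out)"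
    using Cons.prems by (intro exec_insert_var sign_char_cases) auto
  from exec_While_True[OF _ this Cons.IH] show ?case
    by (rule exec_cong)
      (use Cons.prems sign_char_cases[of k] length_add_var[of vs "lit_var k"] in
        \<open>auto simp: enc_literal_eq[of k]\<close>)
qed

lemma exec_collect:
  assumes "\<forall>v\<in>set vs \<union> set (clause_vars Cs). length (enc_nat v) \<le> N"
    and "length vs + length (clause_vars Cs) \<le> M" "\<forall>C\<in>set Cs. length C = 3"
  shows "exec collect (l, enc_body Cs, rev (hash # enc_vars vs), [], out)
    (length Cs * (75 * (N + 1) * (M + 1) + 10) + 1)
    (rev (enc_body Cs) @ l, [], rev (hash # enc_vars (foldl add_var vs (clause_vars Cs))), [], out)"
  using assms
proof (induction Cs arbitrary: vs l)
  case Nil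
  show ?case unfolding collect_def by (rule exec_cong[OF exec_While_False]) auto
next
  case (Cons C Cs)
  let ?vs = "foldl add_var vs (map lit_var C)" and ?l = "rev (concat (map enc_literal C)) @ l"
  have *: "\<forall>v\<in>set vs \<union> lit_var ` set C. length (enc_nat v) \<le> N" "length vs + length C \<le> M"
    using Cons.prems by auto
  have "exec (Op R0) (?l, semi # enc_body Cs, rev (hash # enc_vars ?vs), [], out) 1
      (semi # ?l, enc_body Cs, rev (hash # enc_vars ?vs), [], out)"
    by (rule exec_Op) simp
  from exec_Seq[OF exec_insert_vars[OF *] this]
  have body: "exec (While (\<lambda>x _. x \<noteq> Some semi) insert_var ;; Op R0)
      (l, enc_body (C # Cs), rev (hash # enc_vars vs), [], out)
      (75 * (N + 1) * (M + 1) + 8) (semi # ?l, enc_body Cs, rev (hash # enc_vars ?vs), [], out)"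
    by (rule exec_cong) (use Cons.prems in \<open>auto simp: algebra_simps\<close>)
  have "length ?vs \<le> length vs + length C"
    using length_foldl_add_var[of vs "map lit_var C"] by simp
  then have "exec collect (semi # ?l, enc_body Cs, rev (hash # enc_vars ?vs), [], out)
    (length Cs * (75 * (N + 1) * (M + 1) + 10) + 1)
    (rev (enc_body Cs) @ semi # ?l, [], rev (hash # enc_vars (foldl add_var ?vs (clause_vars Cs))), [], out)"
    using Cons.prems by (intro Cons.IH) auto
  from exec_While_True[OF _ body this[unfolded collect_def]] show ?case
    unfolding collect_def by (rule exec_cong) (auto simp: hd_opt_eq_None)
qed


text \<open>Here one move precedes the loop: the head may stand on a symbol that would stop the loop
  at once, such as the separator closing the word to be walked back over. So nothing is assumed
  about \<open>r\<close>, and an empty \<open>u\<close> is a case of its own.\<close>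

lemma exec_back0:
  assumes "\<forall>c\<in>set u. p (Some c)" "\<not> p (Some k)"
  shows "exec (Op L0 ;; While (\<lambda>x _. p x) (Op L0) ;; Op R0) (rev u @ k # l, r, l', r', out)
    (3 * length u + 3) (k # l, u @ r, l', r', out)"
proof (cases u rule: rev_exhaust)
  case Nil
  have "exec (Op L0) (k # l, r, l', r', out) 1 (l, k # r, l', r', out)"
    by (rule exec_Op) simp
  moreover have "exec (While (\<lambda>x _. p x) (Op L0)) (l, k # r, l', r', out) 1 (l, k # r, l', r', out)"
    by (rule exec_While_False) (use assms in simp)
  moreover have "exec (Op R0) (l, k # r, l', r', out) 1 (k # l, r, l', r', out)"
    by (rule exec_Op) simp
  ultimately show ?thesis
    using Nil by (auto intro!: exec_cong[OF exec_Seq[OF _ exec_Seq]])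
next
  case (snoc u' c)
  have "exec (Op L0) (c # rev u' @ k # l, r, l', r', out) 1 (rev u' @ k # l, c # r, l', r', out)"
    by (rule exec_Op) simp
  from exec_Seq[OF this exec_skip_L0[of p "c # r" u' k]] show ?thesis
    by (rule exec_cong) (use assms snoc in auto)
qed

lemma exec_back1:
  assumes "\<forall>c\<in>set u. p (Some c)" "\<not> p (Some k)"
  shows "exec (Op L1 ;; While (\<lambda>_ y. p y) (Op L1) ;; Op R1) (l, r, rev u @ k # l', r', out)
    (3 * length u + 3) (l, r, k # l', u @ r', out)"
proof (cases u rule: rev_exhaust)
  case Nil
  have "exec (Op L1) (l, r, k # l', r', out) 1 (l, r, l', k # r', out)"
    by (rule exec_Op) simp
  moreover have "exec (While (\<lambda>_ y. p y) (Op L1)) (l, r, l', k # r', out) 1 (l, r, l', k # r', out)"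
    by (rule exec_While_False) (use assms in simp)
  moreover have "exec (Op R1) (l, r, l', k # r', out) 1 (l, r, k # l', r', out)"
    by (rule exec_Op) simp
  ultimately show ?thesis
    using Nil by (auto intro!: exec_cong[OF exec_Seq[OF _ exec_Seq]])
next
  case (snoc u' c)
  have "exec (Op L1) (l, r, c # rev u' @ k # l', r', out) 1 (l, r, rev u' @ k # l', c # r', out)"
    by (rule exec_Op) simp
  from exec_Seq[OF this exec_skip_L1[of p "c # r'" u' k]] show ?thesis
    by (rule exec_cong) (use assms snoc in auto)
qed

section \<open>Programs for single rows\<close>

definition emit_row :: "cmd \<Rightarrow> cmd" where
  "emit_row c = While (\<lambda>_ y. y \<noteq> None) c ;; Op (Emit semi) ;; rewind1"

text \<open>This serves clause rows and gadget rows alike: the body may be any program that consumes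
  one name on the work tape, emits the three entries \<open>f v\<close> of its columns, and leaves
  the input tape as it was.\<close>

lemma exec_emit_row:
  assumes body: "\<And>pre v post out. vs = pre @ v # post \<Longrightarrow>
      exec c (l, r, rev (hash # enc_vars pre), enc_nat v @ comma # enc_vars post, out) t
        (l, r, comma # rev (enc_nat v) @ rev (hash # enc_vars pre), enc_vars post, rev (f v) @ out)"
    and vs: "\<forall>v\<in>set vs. length (enc_nat v) \<le> N" "length vs \<le> M"
    and T: "M * (t + 3 * N + 5) + 7 \<le> T"
  shows "exec (emit_row c) (l, r, [hash], enc_vars vs, out) T
    (l, r, [hash], enc_vars vs, rev (concat (map f vs) @ [semi]) @ out)"
proof -
  let ?b = "\<lambda>_ y. y \<noteq> None"
  have loop: "vs = pre @ post \<Longrightarrow>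
      exec (While ?b c) (l, r, rev (hash # enc_vars pre), enc_vars post, out) (length post * (t + 2) + 1)
        (l, r, rev (hash # enc_vars (pre @ post)), [], rev (concat (map f post)) @ out)" for pre post out
  proof (induction post arbitrary: pre out)
    case Nil
    show ?case by (rule exec_cong[OF exec_While_False]) auto
  next
    case (Cons v post)
    have "vs = (pre @ [v]) @ post" using Cons.prems by simp
    from exec_While_True[OF _ body[OF Cons.prems] exec_cong[OF Cons.IH[OF this]]]
    show ?case by (rule exec_cong) (auto simp: hd_opt_eq_None)
  qed
  have len: "length (enc_vars vs) \<le> M * (N + 1)"
    using length_enc_vars vs by blast
  have "length vs * (t + 2) \<le> M * (t + 2)"
    using vs(2) by (rule mult_le_mono1)
  then have time: "length vs * (t + 2) + 1 + (1 + (3 * (M * (N + 1)) + 5)) \<le> T"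
    using T by (simp add: algebra_simps)
  have 1: "exec (While ?b c) (l, r, [hash], enc_vars vs, out) (length vs * (t + 2) + 1)
      (l, r, rev (hash # enc_vars vs), [], rev (concat (map f vs)) @ out)"
    using loop[of "[]" vs out] by simp
  have 2: "exec (Op (Emit semi)) (l, r, rev (hash # enc_vars vs), [], rev (concat (map f vs)) @ out) 1
      (l, r, rev (hash # enc_vars vs), [], rev (concat (map f vs) @ [semi]) @ out)"
    by (rule exec_Op) simp
  have 3: "exec rewind1 (l, r, rev (hash # enc_vars vs), [], rev (concat (map f vs) @ [semi]) @ out)
      (3 * (M * (N + 1)) + 5) (l, r, [hash], enc_vars vs, rev (concat (map f vs) @ [semi]) @ out)"
    by (rule exec_cong[OF exec_rewind1[where u = "enc_vars vs"]]) (use len in auto)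
  show ?thesis
    unfolding emit_row_def by (rule exec_mono[OF exec_Seq[OF 1 exec_Seq[OF 2 3]] time])
qed

definition enc_entries :: "rat list \<Rightarrow> string" where
  "enc_entries qs = concat (map (\<lambda>q. enc_rat q @ '','') qs)"

definition gadget_entry :: "rat list \<Rightarrow> cmd" where
  "gadget_entry qs = compare ;;
     Cond both_commas (emits (enc_entries qs)) (emits (enc_entries [0, 0, 0])) ;; restore0 ;; skip1"

lemma exec_gadget_entry:
  assumes g: "g = CHR ''+'' \<or> g = CHR ''-''"
    and N: "length (enc_nat u) \<le> N" "length (enc_nat v) \<le> N"
    and E: "length (enc_entries qs) \<le> E" "length (enc_entries [0, 0, 0]) \<le> E"
  shows "exec (gadget_entry qs) (g # l, enc_nat u @ comma # x, l', enc_nat v @ comma # y, out)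
    (10 * N + E + 10)
    (g # l, enc_nat u @ comma # x, comma # rev (enc_nat v) @ l', y,
     rev (enc_entries (if u = v then qs else [0, 0, 0])) @ out)"
proof -
  obtain a s s' where as: "enc_nat u = a @ s" "enc_nat v = a @ s'"
    "s = [] \<and> s' = [] \<longleftrightarrow> enc_nat u = enc_nat v"
    and 1: "exec compare (g # l, enc_nat u @ comma # x, l', enc_nat v @ comma # y, out)
      (4 * length (enc_nat u) + 1)
      (rev a @ g # l, s @ comma # x, rev a @ l', s' @ comma # y, out)"
    using exec_compare[OF enc_nat_digits enc_nat_digits, of u v "g # l" x l' y out thesis] by blast
  have dig: "set a \<subseteq> digits" "set s \<subseteq> digits" "set s' \<subseteq> digits"
    using enc_nat_digits[of u] enc_nat_digits[of v] as by auto
  let ?e = "enc_entries (if u = v then qs else [0, 0, 0])"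
  have 2: "exec (Cond both_commas (emits (enc_entries qs)) (emits (enc_entries [0, 0, 0])))
      (rev a @ g # l, s @ comma # x, rev a @ l', s' @ comma # y, out) (E + 2)
      (rev a @ g # l, s @ comma # x, rev a @ l', s' @ comma # y, rev ?e @ out)"
    using as(3) dig E
    by (intro exec_If) (auto simp: both_commas_def hd_opt_digits_neq_comma intro!: exec_mono[OF exec_emits])
  have 3: "exec restore0 (rev a @ g # l, s @ comma # x, rev a @ l', s' @ comma # y, rev ?e @ out)
      (3 * N + 5) (g # l, a @ s @ comma # x, rev a @ l', s' @ comma # y, rev ?e @ out)"
    by (rule exec_restore0) (use dig g as N in auto)
  have 4: "exec skip1 (g # l, a @ s @ comma # x, rev a @ l', s' @ comma # y, rev ?e @ out)
      (3 * N + 2) (g # l, a @ s @ comma # x, comma # rev s' @ rev a @ l', y, rev ?e @ out)"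
    by (rule exec_skip1) (use dig as N in auto)
  show ?thesis
    unfolding gadget_entry_def
    by (rule exec_cong[OF exec_Seq[OF 1 exec_Seq[OF 2 exec_Seq[OF 3 4]]]]) (use as N in auto)
qed

definition gadget :: "nat \<Rightarrow> rat list" where
  "gadget k = map (\<lambda>j. if j = k then -1 else 1) [0..<3]"

definition gadget_row :: "nat list \<Rightarrow> literal \<Rightarrow> nat \<Rightarrow> rat list" where
  "gadget_row vs l k = concat (map (\<lambda>v. if lit_var l = v then gadget k else [0, 0, 0]) vs)"

definition enc_row :: "rat list \<Rightarrow> string" where
  "enc_row qs = enc_entries qs @ [semi]"

definition literal_block :: cmd where
  "literal_block = Op R0 ;; emit_row (gadget_entry (gadget 0)) ;;
     emit_row (gadget_entry (gadget 1)) ;; emit_row (gadget_entry (gadget 2)) ;; skip0"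

lemma enc_entries_concat: "enc_entries (concat qss) = concat (map enc_entries qss)"
  by (induction qss) (auto simp: enc_entries_def)

lemma exec_gadget_row:
  assumes "\<forall>v\<in>insert (lit_var k) (set vs). length (enc_nat v) \<le> N" "length vs \<le> M"
    and "length (enc_entries (gadget i)) \<le> E" "length (enc_entries [0, 0, 0]) \<le> E"
    and "M * (13 * N + E + 15) + 7 \<le> T"
  shows "exec (emit_row (gadget_entry (gadget i)))
    (sign_char k # l, enc_nat (lit_var k) @ comma # x, [hash], enc_vars vs, out) T
    (sign_char k # l, enc_nat (lit_var k) @ comma # x, [hash], enc_vars vs,
     rev (enc_row (gadget_row vs k i)) @ out)"
proof -
  have "exec (emit_row (gadget_entry (gadget i)))
    (sign_char k # l, enc_nat (lit_var k) @ comma # x, [hash], enc_vars vs, out) T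
    (sign_char k # l, enc_nat (lit_var k) @ comma # x, [hash], enc_vars vs,
     rev (concat (map (\<lambda>v. enc_entries (if lit_var k = v then gadget i else [0, 0, 0])) vs) @ [semi]) @ out)"
  proof (rule exec_emit_row)
    show "exec (gadget_entry (gadget i)) (sign_char k # l, enc_nat (lit_var k) @ comma # x,
          rev (hash # enc_vars pre), enc_nat v @ comma # enc_vars post, out) (10 * N + E + 10)
        (sign_char k # l, enc_nat (lit_var k) @ comma # x,
          comma # rev (enc_nat v) @ rev (hash # enc_vars pre), enc_vars post,
          rev (enc_entries (if lit_var k = v then gadget i else [0, 0, 0])) @ out)"
      if "vs = pre @ v # post" for pre v post out
      using that assms sign_char_cases by (intro exec_gadget_entry) auto
  qed (use assms in \<open>auto simp: algebra_simps\<close>)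
  then show ?thesis
    by (simp add: enc_row_def gadget_row_def enc_entries_concat o_def)
qed

definition literal_rows :: "nat list \<Rightarrow> literal \<Rightarrow> rat list list" where
  "literal_rows vs l = map (gadget_row vs l) [0..<3]"

definition enc_rows :: "rat list list \<Rightarrow> string" where
  "enc_rows qss = concat (map enc_row qss)"

lemma enc_rows_simps [simp]:
  "enc_rows [] = []" "enc_rows (r # rs) = enc_row r @ enc_rows rs"
  "enc_rows (rs @ rs') = enc_rows rs @ enc_rows rs'"
  by (auto simp: enc_rows_def)

lemma exec_literal_block:
  assumes N: "\<forall>v\<in>insert (lit_var k) (set vs). length (enc_nat v) \<le> N" "length vs \<le> M"
    and E: "\<forall>i<3. length (enc_entries (gadget i)) \<le> E" "length (enc_entries [0, 0, 0]) \<le> E"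
    and T: "M * (13 * N + E + 15) + 7 \<le> T"
  shows "exec literal_block (l, enc_literal k @ x, [hash], enc_vars vs, out)
    (3 * T + 3 * N + 3)
    (rev (enc_literal k) @ l, x, [hash], enc_vars vs, rev (enc_rows (literal_rows vs k)) @ out)"
proof -
  let ?l = "sign_char k # l" and ?r = "enc_nat (lit_var k) @ comma # x"
  have 1: "exec (Op R0) (l, enc_literal k @ x, [hash], enc_vars vs, out) 1
      (?l, ?r, [hash], enc_vars vs, out)"
    by (rule exec_Op) (simp add: enc_literal_eq)
  have row: "exec (emit_row (gadget_entry (gadget i))) (?l, ?r, [hash], enc_vars vs, out) T
      (?l, ?r, [hash], enc_vars vs, rev (enc_row (gadget_row vs k i)) @ out)" if "i < 3" for i out
    using that assms by (intro exec_gadget_row) auto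
  have 2: "exec skip0 (?l, ?r, [hash], enc_vars vs, out) (3 * N + 2)
      (comma # rev (enc_nat (lit_var k)) @ ?l, x, [hash], enc_vars vs, out)" for out
    using N enc_nat_digits by (intro exec_skip0) auto
  show ?thesis
    unfolding literal_block_def
    by (rule exec_cong[OF exec_Seq[OF 1 exec_Seq[OF row exec_Seq[OF row exec_Seq[OF row 2]]]]])
      (auto simp: enc_literal_eq literal_rows_def eval_nat_numeral)
qed

text \<open>The first \<open>Op L1\<close> is unconditional because after a full match the work head
  stands on the comma behind the name, which would already end the loop. The loop must stop at the
  comma or hash in front of the name.\<close>

definition next_literal :: cmd where
  "next_literal = skip0 ;; Op L1 ;; While (\<lambda>_ y. y \<noteq> Some comma \<and> y \<noteq> Some hash) (Op L1) ;; Op R1"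

definition match_literal :: "cmd \<Rightarrow> cmd \<Rightarrow> cmd" where
  "match_literal c d = Op R0 ;; compare ;; Cond both_commas (next_literal ;; c) (next_literal ;; d)"

text \<open>
  The coefficient of a variable in a clause is accumulated in the control state; it is 0 if the
  variable occurs with both signs.
\<close>

fun clause_entry :: "nat \<Rightarrow> int \<Rightarrow> cmd" where
  "clause_entry 0 q = emits (enc_entries (replicate 3 (of_int q / 3))) ;; skip1 ;;
     Op L0 ;; While (\<lambda>x _. x \<noteq> Some semi \<and> x \<noteq> Some hash) (Op L0) ;; Op R0"
| "clause_entry (Suc n) q =
     Cond (\<lambda>x _. x = Some CHR ''+'')
       (match_literal (clause_entry n (q + 1)) (clause_entry n q))
       (match_literal (clause_entry n (q - 1)) (clause_entry n q))"

fun lit_sign :: "literal \<Rightarrow> int" where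
  "lit_sign (Pos v) = 1"
| "lit_sign (Neg v) = -1"

definition clause_coeff :: "clause \<Rightarrow> nat \<Rightarrow> int" where
  "clause_coeff C v = (\<Sum>l\<leftarrow>C. if lit_var l = v then lit_sign l else 0)"

lemma exec_match_literal:
  assumes k': "k' = comma \<or> k' = hash"
    and N: "length (enc_nat (lit_var k)) \<le> N" "length (enc_nat v) \<le> N"
    and cd: "exec (if lit_var k = v then c else d)
      (rev (enc_literal k) @ l, x, k' # l', enc_nat v @ comma # y, out) t s"
  shows "exec (match_literal c d) (l, enc_literal k @ x, k' # l', enc_nat v @ comma # y, out)
    (10 * N + 9 + t) s"
proof -
  let ?u = "enc_nat (lit_var k)"
  have 1: "exec (Op R0) (l, enc_literal k @ x, k' # l', enc_nat v @ comma # y, out) 1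
    (sign_char k # l, ?u @ comma # x, k' # l', enc_nat v @ comma # y, out)"
    by (rule exec_Op) (simp add: enc_literal_eq)
  obtain a s1 s2 where as: "?u = a @ s1" "enc_nat v = a @ s2"
    "s1 = [] \<and> s2 = [] \<longleftrightarrow> ?u = enc_nat v"
    and 2: "exec compare (sign_char k # l, ?u @ comma # x, k' # l', enc_nat v @ comma # y, out)
      (4 * length ?u + 1)
      (rev a @ sign_char k # l, s1 @ comma # x, rev a @ k' # l', s2 @ comma # y, out)"
    using exec_compare[OF enc_nat_digits enc_nat_digits,
        of "lit_var k" v "sign_char k # l" x "k' # l'" y out thesis] by blast
  have dig: "set a \<subseteq> digits" "set s1 \<subseteq> digits" "set s2 \<subseteq> digits"
    using enc_nat_digits[of "lit_var k"] enc_nat_digits[of v] as by auto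
  have 3: "exec skip0 (rev a @ sign_char k # l, s1 @ comma # x, rev a @ k' # l', s2 @ comma # y, out)
      (3 * N + 2) (comma # rev s1 @ rev a @ sign_char k # l, x, rev a @ k' # l', s2 @ comma # y, out)"
    by (rule exec_skip0) (use dig as N in auto)
  have 4: "exec (Op L1 ;; While (\<lambda>_ y. y \<noteq> Some comma \<and> y \<noteq> Some hash) (Op L1) ;; Op R1)
      (comma # rev s1 @ rev a @ sign_char k # l, x, rev a @ k' # l', s2 @ comma # y, out)
      (3 * length a + 3) (comma # rev s1 @ rev a @ sign_char k # l, x, k' # l', a @ s2 @ comma # y, out)"
    by (rule exec_back1[where p = "\<lambda>y. y \<noteq> Some comma \<and> y \<noteq> Some hash"])
      (use dig k' in \<open>auto simp: digits_def\<close>)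
  have "exec next_literal
      (rev a @ sign_char k # l, s1 @ comma # x, rev a @ k' # l', s2 @ comma # y, out)
      (6 * N + 5) (rev (enc_literal k) @ l, x, k' # l', enc_nat v @ comma # y, out)"
    unfolding next_literal_def
    by (rule exec_cong[OF exec_Seq[OF 3 4]]) (use as N in \<open>auto simp: enc_literal_eq\<close>)
  from exec_Seq[OF this cd]
  have 5: "exec (Cond both_commas (next_literal ;; c) (next_literal ;; d))
      (rev a @ sign_char k # l, s1 @ comma # x, rev a @ k' # l', s2 @ comma # y, out) (6 * N + 5 + t + 2) s"
    using as(3) dig
    by (intro exec_If) (auto simp: both_commas_def hd_opt_digits_neq_comma split: if_splits)
  show ?thesis
    unfolding match_literal_def
    by (rule exec_mono[OF exec_Seq[OF 1 exec_Seq[OF 2 5]]]) (use N in auto)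
qed

text \<open>The word \<open>pre\<close> is the part of the clause already read; at the end the input
  head walks back over it to the separator \<open>k\<close>, ready for the next variable. The bound
  on \<open>q\<close> and the remaining length confines the coefficient to seven values, so a
  constant \<open>E\<close> bounds the length of the entries.\<close>

lemma exec_clause_entry:
  assumes "k' = comma \<or> k' = hash" "k = semi \<or> k = hash" "semi \<notin> set pre" "hash \<notin> set pre"
    and "\<forall>u\<in>insert v (lit_var ` set C). length (enc_nat u) \<le> N"
    and "length (pre @ concat (map enc_literal C)) \<le> L"
    and "\<bar>q\<bar> + int (length C) \<le> 3"
    and "\<And>q. \<bar>q\<bar> \<le> 3 \<Longrightarrow> length (enc_entries (replicate 3 (of_int q / 3))) \<le> E"
  shows "exec (clause_entry (length C) q)
    (rev pre @ k # l, concat (map enc_literal C) @ semi # x, k' # l', enc_nat v @ comma # y, out)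
    (length C * (10 * N + 11) + E + 3 * N + 3 * L + 5)
    (k # l, pre @ concat (map enc_literal C) @ semi # x, comma # rev (enc_nat v) @ k' # l', y,
     rev (enc_entries (replicate 3 (of_int (q + clause_coeff C v) / 3))) @ out)"
  using assms
proof (induction C arbitrary: pre q)
  case Nil
  let ?e = "enc_entries (replicate 3 (of_int q / 3))"
  have 1: "exec (emits ?e) (rev pre @ k # l, semi # x, k' # l', enc_nat v @ comma # y, out) (length ?e)
    (rev pre @ k # l, semi # x, k' # l', enc_nat v @ comma # y, rev ?e @ out)"
    by (rule exec_emits)
  have 2: "exec skip1 (rev pre @ k # l, semi # x, k' # l', enc_nat v @ comma # y, rev ?e @ out) (3 * N + 2)
    (rev pre @ k # l, semi # x, comma # rev (enc_nat v) @ k' # l', y, rev ?e @ out)"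
    by (rule exec_skip1) (use Nil.prems enc_nat_digits in auto)
  have 3: "exec (Op L0 ;; While (\<lambda>x _. x \<noteq> Some semi \<and> x \<noteq> Some hash) (Op L0) ;; Op R0)
    (rev pre @ k # l, semi # x, comma # rev (enc_nat v) @ k' # l', y, rev ?e @ out) (3 * length pre + 3)
    (k # l, pre @ semi # x, comma # rev (enc_nat v) @ k' # l', y, rev ?e @ out)"
    by (rule exec_back0[where p = "\<lambda>x. x \<noteq> Some semi \<and> x \<noteq> Some hash"]) (use Nil.prems in auto)
  have "length ?e \<le> E" "length pre \<le> L" using Nil.prems by auto
  then have "length ?e + (3 * N + 2 + (3 * length pre + 3)) \<le> E + 3 * N + 3 * L + 5" by linarith
  then show ?case
    unfolding list.size clause_entry.simps
    by (intro exec_cong[OF exec_Seq[OF 1 exec_Seq[OF 2 3]]]) (auto simp: clause_coeff_def)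
next
  case (Cons h C)
  let ?x = "concat (map enc_literal C) @ semi # x" and ?t = "length C * (10 * N + 11) + E + 3 * N + 3 * L + 5"
  define q' where "q' = (if lit_var h = v then q + lit_sign h else q)"
  have h: "semi \<notin> set (enc_literal h)" "hash \<notin> set (enc_literal h)"
    using enc_literal_chars[of h] by (auto simp: digits_def)
  have "\<bar>q'\<bar> \<le> \<bar>q\<bar> + 1" unfolding q'_def by (cases h) auto
  then have "exec (clause_entry (length C) q')
    (rev (pre @ enc_literal h) @ k # l, ?x, k' # l', enc_nat v @ comma # y, out) ?t
    (k # l, (pre @ enc_literal h) @ ?x, comma # rev (enc_nat v) @ k' # l', y,
     rev (enc_entries (replicate 3 (of_int (q' + clause_coeff C v) / 3))) @ out)"
    using Cons.prems h by (intro Cons.IH) auto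
  then have IH: "exec (clause_entry (length C) q')
    (rev (enc_literal h) @ rev pre @ k # l, ?x, k' # l', enc_nat v @ comma # y, out) ?t
    (k # l, pre @ concat (map enc_literal (h # C)) @ semi # x, comma # rev (enc_nat v) @ k' # l', y,
     rev (enc_entries (replicate 3 (of_int (q + clause_coeff (h # C) v) / 3))) @ out)"
    by (rule exec_cong) (auto simp: q'_def clause_coeff_def add.assoc)
  have M: "exec (match_literal (clause_entry (length C) (q + lit_sign h)) (clause_entry (length C) q))
    (rev pre @ k # l, concat (map enc_literal (h # C)) @ semi # x, k' # l', enc_nat v @ comma # y, out)
    (10 * N + 9 + ?t)
    (k # l, pre @ concat (map enc_literal (h # C)) @ semi # x, comma # rev (enc_nat v) @ k' # l', y,
     rev (enc_entries (replicate 3 (of_int (q + clause_coeff (h # C) v) / 3))) @ out)"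
    by (rule exec_cong[OF exec_match_literal[OF _ _ _ IH[unfolded q'_def if_distrib[of "clause_entry (length C)"]]]])
      (use Cons.prems in auto)
  have time: "10 * N + 9 + ?t + 2 \<le> length (h # C) * (10 * N + 11) + E + 3 * N + 3 * L + 5"
    by simp
  show ?case
  proof (cases h)
    case (Pos u)
    then have "exec (clause_entry (Suc (length C)) q)
        (rev pre @ k # l, concat (map enc_literal (h # C)) @ semi # x, k' # l', enc_nat v @ comma # y, out)
        (10 * N + 9 + ?t + 2)
        (k # l, pre @ concat (map enc_literal (h # C)) @ semi # x, comma # rev (enc_nat v) @ k' # l', y,
         rev (enc_entries (replicate 3 (of_int (q + clause_coeff (h # C) v) / 3))) @ out)"
      unfolding clause_entry.simps
      by (intro exec_If_True) (use M in simp_all)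
    from exec_mono[OF this time] show ?thesis by simp
  next
    case (Neg u)
    then have "exec (clause_entry (Suc (length C)) q)
        (rev pre @ k # l, concat (map enc_literal (h # C)) @ semi # x, k' # l', enc_nat v @ comma # y, out)
        (10 * N + 9 + ?t + 2)
        (k # l, pre @ concat (map enc_literal (h # C)) @ semi # x, comma # rev (enc_nat v) @ k' # l', y,
         rev (enc_entries (replicate 3 (of_int (q + clause_coeff (h # C) v) / 3))) @ out)"
      unfolding clause_entry.simps
      by (intro exec_If_False) (use M in simp_all)
    from exec_mono[OF this time] show ?thesis by simp
  qed
qed

section \<open>Emitting the matrix\<close>

definition clause_row :: "nat list \<Rightarrow> clause \<Rightarrow> rat list" where
  "clause_row vs C = concat (map (\<lambda>v. replicate 3 (of_int (clause_coeff C v) / 3)) vs)"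

definition clause_rows :: "nat list \<Rightarrow> clause \<Rightarrow> rat list list" where
  "clause_rows vs C = clause_row vs C # concat (map (literal_rows vs) C)"

definition matrix_rows :: "nat list \<Rightarrow> clause list \<Rightarrow> rat list list" where
  "matrix_rows vs Cs = concat (map (clause_rows vs) Cs)"

text \<open>Every clause entry returns the input head to the start of the clause, so after the
  clause row the literal blocks can consume the same clause.\<close>

definition clause_block :: cmd where
  "clause_block = emit_row (clause_entry 3 0) ;;
     While (\<lambda>x _. x \<noteq> Some semi) literal_block ;; Op R0"

definition emit_matrix :: cmd where
  "emit_matrix = While (\<lambda>x _. x \<noteq> None) clause_block"

lemma exec_literal_blocks:
  assumes "\<forall>v\<in>lit_var ` set C \<union> set vs. length (enc_nat v) \<le> N" "length vs \<le> M"
    and "\<forall>i<3. length (enc_entries (gadget i)) \<le> E" "length (enc_entries [0, 0, 0]) \<le> E"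
    and "M * (13 * N + E + 15) + 7 \<le> T"
  shows "exec (While (\<lambda>x _. x \<noteq> Some semi) literal_block)
    (l, concat (map enc_literal C) @ semi # x, [hash], enc_vars vs, out)
    (length C * (3 * T + 3 * N + 5) + 1)
    (rev (concat (map enc_literal C)) @ l, semi # x, [hash], enc_vars vs,
     rev (enc_rows (concat (map (literal_rows vs) C))) @ out)"
  using assms
proof (induction C arbitrary: l out)
  case Nil
  show ?case by (rule exec_cong[OF exec_While_False]) auto
next
  case (Cons k C)
  have "exec literal_block (l, enc_literal k @ concat (map enc_literal C) @ semi # x, [hash], enc_vars vs, out)
    (3 * T + 3 * N + 3)
    (rev (enc_literal k) @ l, concat (map enc_literal C) @ semi # x, [hash], enc_vars vs,
     rev (enc_rows (literal_rows vs k)) @ out)"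
    using Cons.prems by (intro exec_literal_block) auto
  from exec_While_True[OF _ this Cons.IH] show ?case
    by (rule exec_cong) (use Cons.prems sign_char_cases[of k] in \<open>auto simp: enc_literal_eq[of k]\<close>)
qed

lemma exec_clause_block:
  assumes C: "length C = 3" and k: "k = semi \<or> k = hash"
    and N: "\<forall>v\<in>lit_var ` set C \<union> set vs. length (enc_nat v) \<le> N" "length vs \<le> M"
      "length (concat (map enc_literal C)) \<le> N"
    and E: "\<forall>i<3. length (enc_entries (gadget i)) \<le> E" "length (enc_entries [0, 0, 0]) \<le> E"
      "\<And>q. \<bar>q\<bar> \<le> 3 \<Longrightarrow> length (enc_entries (replicate 3 (of_int q / 3))) \<le> E"
    and T: "M * (39 * N + E + 43) + 7 \<le> T"
  shows "exec clause_block (k # l, concat (map enc_literal C) @ semi # x, [hash], enc_vars vs, out)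
    (10 * T + 9 * N + 17)
    (semi # rev (concat (map enc_literal C)) @ k # l, x, [hash], enc_vars vs,
     rev (enc_rows (clause_rows vs C)) @ out)"
proof -
  let ?C = "concat (map enc_literal C)"
  have entry: "exec (clause_entry 3 0)
      (k # l, ?C @ semi # x, rev (hash # enc_vars pre), enc_nat v @ comma # enc_vars post, out)
      (36 * N + E + 38)
      (k # l, ?C @ semi # x, comma # rev (enc_nat v) @ rev (hash # enc_vars pre), enc_vars post,
       rev (enc_entries (replicate 3 (of_int (clause_coeff C v) / 3))) @ out)"
    if "vs = pre @ v # post" for pre v post out
  proof -
    obtain k' l' where kl: "rev (hash # enc_vars pre) = k' # l'" "k' = comma \<or> k' = hash"
      by (cases pre rule: rev_exhaust) auto
    show ?thesis
      using exec_clause_entry[of k' k "[]" v C N N 0 E l x l' "enc_vars post" out] that C N E k kl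
      by (auto elim!: exec_cong)
  qed
  have 1: "exec (emit_row (clause_entry 3 0)) (k # l, ?C @ semi # x, [hash], enc_vars vs, out) T
    (k # l, ?C @ semi # x, [hash], enc_vars vs, rev (enc_row (clause_row vs C)) @ out)"
  proof -
    have "exec (emit_row (clause_entry 3 0)) (k # l, ?C @ semi # x, [hash], enc_vars vs, out) T
      (k # l, ?C @ semi # x, [hash], enc_vars vs,
       rev (concat (map (\<lambda>v. enc_entries (replicate 3 (of_int (clause_coeff C v) / 3))) vs) @ [semi]) @ out)"
      by (rule exec_emit_row[OF entry]) (use N T in \<open>auto simp: algebra_simps\<close>)
    then show ?thesis
      by (simp add: enc_row_def clause_row_def enc_entries_concat o_def)
  qed
  have T': "M * (13 * N + E + 15) + 7 \<le> T"
    using T mult_le_mono2[of "13 * N + E + 15" "39 * N + E + 43" M] by linarith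
  note 2 = exec_literal_blocks[OF N(1,2) E(1,2) T', of "k # l" x "rev (enc_row (clause_row vs C)) @ out"]
  have 3: "exec (Op R0) (l, semi # x, l', r', out) 1 (semi # l, x, l', r', out)" for l l' r' out
    by (rule exec_Op) simp
  show ?thesis
    unfolding clause_block_def
    by (rule exec_cong[OF exec_Seq[OF 1 exec_Seq[OF 2 3]]]) (auto simp: C clause_rows_def)
qed

lemma exec_emit_matrix:
  assumes k: "k = semi \<or> k = hash"
    and N: "\<forall>v\<in>set (clause_vars Cs) \<union> set vs. length (enc_nat v) \<le> N" "length vs \<le> M"
      "\<forall>C\<in>set Cs. length C = 3 \<and> length (concat (map enc_literal C)) \<le> N"
    and E: "\<forall>i<3. length (enc_entries (gadget i)) \<le> E" "length (enc_entries [0, 0, 0]) \<le> E"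
      "\<And>q. \<bar>q\<bar> \<le> 3 \<Longrightarrow> length (enc_entries (replicate 3 (of_int q / 3))) \<le> E"
    and T: "M * (39 * N + E + 43) + 7 \<le> T"
  shows "exec emit_matrix (k # l, enc_body Cs, [hash], enc_vars vs, out)
    (length Cs * (10 * T + 9 * N + 19) + 1)
    (rev (enc_body Cs) @ k # l, [], [hash], enc_vars vs, rev (enc_rows (matrix_rows vs Cs)) @ out)"
  using k N
proof (induction Cs arbitrary: k l out)
  case Nil
  show ?case unfolding emit_matrix_def by (rule exec_cong[OF exec_While_False]) (auto simp: matrix_rows_def)
next
  case (Cons C Cs)
  let ?C = "concat (map enc_literal C)"
  have "exec clause_block (k # l, ?C @ semi # enc_body Cs, [hash], enc_vars vs, out)
    (10 * T + 9 * N + 17)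
    (semi # rev ?C @ k # l, enc_body Cs, [hash], enc_vars vs, rev (enc_rows (clause_rows vs C)) @ out)"
    using Cons.prems by (intro exec_clause_block[OF _ _ _ _ _ E T]) auto
  from exec_While_True[OF _ this Cons.IH[unfolded emit_matrix_def]] show ?case
    unfolding emit_matrix_def by (rule exec_cong) (use Cons.prems in \<open>auto simp: matrix_rows_def\<close>)
qed

text \<open>Each clause ends with the only semicolon that belongs to it, so one scan repeats
  \<open>w\<close> once per clause. This is how the number of clauses enters the radius without
  binary counting.\<close>

definition tally :: "string \<Rightarrow> cmd" where
  "tally w = While (\<lambda>x _. x \<noteq> None) (Cond (\<lambda>x _. x = Some semi) (emits w) Skip ;; Op R0)"

lemma exec_tally:
  "exec (tally w) (l, u, l', r', out) (length u * (length w + 5) + 1)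
    (rev u @ l, [], l', r', rev (concat (map (\<lambda>c. if c = semi then w else []) u)) @ out)"
proof (induction u arbitrary: l out)
  case Nil
  show ?case unfolding tally_def by (rule exec_cong[OF exec_While_False]) auto
next
  case (Cons c u)
  let ?out = "rev (if c = semi then w else []) @ out"
  have 1: "exec (Cond (\<lambda>x _. x = Some semi) (emits w) Skip) (l, c # u, l', r', out) (length w + 2)
      (l, c # u, l', r', ?out)"
    by (rule exec_If) (auto intro: exec_emits exec_mono[OF exec_Skip])
  have 2: "exec (Op R0) (l, c # u, l', r', ?out) 1 (c # l, u, l', r', ?out)"
    by (rule exec_Op) simp
  from exec_While_True[OF _ exec_Seq[OF 1 2] Cons.IH[unfolded tally_def]] show ?case
    unfolding tally_def by (rule exec_cong) auto
qed

lemma tally_enc_body: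
  "concat (map (\<lambda>c. if c = semi then w else []) (enc_body Cs)) = concat (replicate (length Cs) w)"
proof (induction Cs)
  case (Cons C Cs)
  have "concat (map (\<lambda>c. if c = semi then w else []) u) = []" if "semi \<notin> set u" for u
    using that by (induction u) auto
  with Cons hash_semi_literals(2)[of C] show ?case by (simp del: set_concat)
qed simp

text \<open>
  Columns belong to the variables that occur in some clause: the number of variables in the
  header is written in binary, so it can be exponential in the length of the input.
\<close>

definition reduction :: "string \<Rightarrow> string \<Rightarrow> string \<Rightarrow> cmd" where
  "reduction w1 w w2 = While (\<lambda>x _. x \<noteq> Some hash) (Op R0) ;; Op R0 ;; Op (Put hash) ;; collect ;;
     rewind0 ;; rewind1 ;; emit_matrix ;; emits w1 ;; rewind0 ;; tally w ;; emits w2"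

section \<open>Polynomial running time of the complete program\<close>

definition used_vars :: "clause list \<Rightarrow> nat list" where
  "used_vars Cs = foldl add_var [] (clause_vars Cs)"

lemma set_used_vars [simp]: "set (used_vars Cs) = set (clause_vars Cs)"
  by (simp add: used_vars_def)

lemma distinct_used_vars: "distinct (used_vars Cs)"
  by (simp add: used_vars_def distinct_foldl_add_var)

lemma length_used_vars: "length (used_vars Cs) \<le> length (clause_vars Cs)"
  using length_foldl_add_var[of "[]" "clause_vars Cs"] by (simp add: used_vars_def)

lemma enc_body_bounds:
  "length Cs \<le> length (enc_body Cs)"
  "length (clause_vars Cs) \<le> length (enc_body Cs)"
  "v \<in> set (clause_vars Cs) \<Longrightarrow> length (enc_nat v) \<le> length (enc_body Cs)"
  "C \<in> set Cs \<Longrightarrow> length (concat (map enc_literal C)) \<le> length (enc_body Cs)"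
proof -
  show "length Cs \<le> length (enc_body Cs)"
    by (induction Cs) auto
  have C: "length C \<le> length (concat (map enc_literal C))" for C
    by (induction C) (auto simp: enc_literal_eq simp del: length_concat)
  show "length (clause_vars Cs) \<le> length (enc_body Cs)"
  proof (induction Cs)
    case (Cons D Cs)
    then show ?case using C[of D] by (simp del: length_concat)
  qed simp
  have v: "v \<in> lit_var ` set C \<Longrightarrow> length (enc_nat v) \<le> length (concat (map enc_literal C))" for C
    by (induction C) (auto simp: enc_literal_eq simp del: length_concat)
  show "v \<in> set (clause_vars Cs) \<Longrightarrow> length (enc_nat v) \<le> length (enc_body Cs)"
  proof (induction Cs)
    case (Cons D Cs)
    then show ?case using v[of D] by (auto simp del: length_concat)
  qed simp
  show "C \<in> set Cs \<Longrightarrow> length (concat (map enc_literal C)) \<le> length (enc_body Cs)"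
    by (induction Cs) (auto simp del: length_concat)
qed

lemma enc_formula_eq: "enc_formula (n, Cs) = enc_nat n @ hash # enc_body Cs"
  by (simp add: enc_formula_def enc_body_def enc_clause_def[abs_def])

text \<open>The input length bounds the length of every name and clause, the number of clauses and
  the number of listed variables, so it can replace all size parameters of the execution
  lemmas.\<close>

lemma reduction_polytime:
  "\<exists>P :: nat poly. \<forall>\<phi>. nae_e3_formula \<phi> \<longrightarrow>
     computes_within (machine (reduction w1 w w2)) (enc_formula \<phi>)
       (enc_rows (matrix_rows (used_vars (snd \<phi>)) (snd \<phi>)) @ w1 @
          concat (replicate (length (snd \<phi>)) w) @ w2)
       (poly P (length (enc_formula \<phi>)))"
proof -
  \<comment> \<open>Only finitely many blocks of three entries ever occur, and the sum of their
    lengths is a crude common bound.\<close>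
  define E where "E = (\<Sum>q\<in>{-3..3::int}. length (enc_entries (replicate 3 (of_int q / 3)))) +
    (\<Sum>i<3. length (enc_entries (gadget i))) + length (enc_entries [0, 0, 0])"
  have E1: "\<forall>i<3. length (enc_entries (gadget i)) \<le> E"
  proof (intro allI impI)
    fix i :: nat assume "i < 3"
    then have "length (enc_entries (gadget i)) \<le> (\<Sum>i<3. length (enc_entries (gadget i)))"
      by (intro member_le_sum) auto
    then show "length (enc_entries (gadget i)) \<le> E" by (simp add: E_def)
  qed
  have E2: "length (enc_entries [0, 0, 0]) \<le> E" by (simp add: E_def)
  have E3: "length (enc_entries (replicate 3 (of_int q / 3))) \<le> E" if "\<bar>q\<bar> \<le> 3" for q
  proof -
    have "length (enc_entries (replicate 3 (of_int q / 3))) \<le>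
        (\<Sum>q\<in>{-3..3::int}. length (enc_entries (replicate 3 (of_int q / 3))))"
      using that
      by (intro member_le_sum[of q _ "\<lambda>q. length (enc_entries (replicate 3 (of_int q / 3)))"]) auto
    then show ?thesis by (simp add: E_def)
  qed
  define X :: "nat poly" where "X = [:0, 1:]"
  define c :: "nat \<Rightarrow> nat poly" where "c = (\<lambda>n. [:n:])"
  define T where "T = X * (c 39 * X + c (E + 43)) + c 7"
  \<comment> \<open>The summands are the time bounds of the successive parts of
    \<open>reduction\<close>, nested in the same way as the sequence.\<close>
  define P where "P = (c 3 * X + c 1) + (c 1 + (c 1 + ((X * (c 75 * (X + c 1) * (X + c 1) + c 10) + c 1) +
    ((c 3 * X + c 5) + ((c 3 * (X * (X + c 1)) + c 5) + ((X * (c 10 * T + c 9 * X + c 19) + c 1) +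
    (c (length w1) + ((c 3 * X + c 5) + ((X * c (length w + 5) + c 1) + c (length w2))))))))))"
  have "computes_within (machine (reduction w1 w w2)) (enc_formula (n, Cs))
      (enc_rows (matrix_rows (used_vars Cs) Cs) @ w1 @ concat (replicate (length Cs) w) @ w2)
      (poly P (length (enc_formula (n, Cs))))"
    if F: "nae_e3_formula (n, Cs)" for n Cs
  proof -
    define N where "N = length (enc_formula (n, Cs))"
    have body: "length (enc_body Cs) \<le> N" and n: "length (enc_nat n) \<le> N"
      by (simp_all add: N_def enc_formula_eq)
    let ?B = "enc_body Cs" and ?vs = "used_vars Cs" and ?l = "rev (enc_nat n)"
    define out1 where "out1 = enc_rows (matrix_rows ?vs Cs)"
    have len3: "\<forall>C\<in>set Cs. length C = 3" using F by (auto simp: nae_e3_formula_def)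
    have vars: "\<forall>v\<in>set (clause_vars Cs) \<union> set ?vs. length (enc_nat v) \<le> N"
      using enc_body_bounds(3) body by (auto intro: order_trans)
    have lenvs: "length ?vs \<le> N" "length (clause_vars Cs) \<le> N" "length Cs \<le> N"
      using length_used_vars[of Cs] enc_body_bounds(1,2)[of Cs] body by linarith+
    have 1: "exec (While (\<lambda>x _. x \<noteq> Some hash) (Op R0)) ([], enc_nat n @ hash # ?B, [], [], [])
        (3 * N + 1) (?l, hash # ?B, [], [], [])"
      using enc_nat_digits[of n] n
      by (intro exec_cong[OF exec_skip_R0[where p = "\<lambda>x. x \<noteq> Some hash"]]) (auto simp: digits_def)
    have 2: "exec (Op R0) (?l, hash # ?B, [], [], []) 1 (hash # ?l, ?B, [], [], [])"
      by (rule exec_Op) simp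
    have 3: "exec (Op (Put hash)) (hash # ?l, ?B, [], [], []) 1 (hash # ?l, ?B, [hash], [], [])"
      by (rule exec_Op) simp
    have 4: "exec collect (hash # ?l, ?B, [hash], [], []) (N * (75 * (N + 1) * (N + 1) + 10) + 1)
        (rev ?B @ hash # ?l, [], rev (hash # enc_vars ?vs), [], [])"
      by (rule exec_cong[OF exec_collect[of "[]" Cs N N]])
        (use vars lenvs len3 in \<open>auto simp: used_vars_def intro!: mult_le_mono1\<close>)
    have 5: "exec rewind0 (rev ?B @ hash # ?l, [], rev (hash # enc_vars ?vs), [], []) (3 * N + 5)
        (hash # ?l, ?B, rev (hash # enc_vars ?vs), [], [])"
      by (rule exec_cong[OF exec_rewind0[of ?B "[]"]]) (use body in auto)
    have 6: "exec rewind1 (hash # ?l, ?B, rev (hash # enc_vars ?vs), [], [])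
        (3 * (N * (N + 1)) + 5) (hash # ?l, ?B, [hash], enc_vars ?vs, [])"
      by (rule exec_cong[OF exec_rewind1[where u = "enc_vars ?vs"]])
        (use length_enc_vars[of ?vs N N] vars lenvs in auto)
    have "exec emit_matrix (hash # ?l, ?B, [hash], enc_vars ?vs, [])
        (length Cs * (10 * poly T N + 9 * N + 19) + 1)
        (rev ?B @ hash # ?l, [], [hash], enc_vars ?vs, rev out1 @ [])"
      unfolding out1_def
      by (rule exec_emit_matrix[OF _ vars lenvs(1) _ E1 E2 E3])
        (use len3 body enc_body_bounds(4)[of _ Cs] in
          \<open>auto simp: T_def X_def c_def intro: order_trans simp del: length_concat\<close>)
    then have 7: "exec emit_matrix (hash # ?l, ?B, [hash], enc_vars ?vs, [])
        (N * (10 * poly T N + 9 * N + 19) + 1)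
        (rev ?B @ hash # ?l, [], [hash], enc_vars ?vs, rev out1)"
      by (rule exec_cong) (use lenvs in \<open>auto intro!: mult_le_mono1\<close>)
    have 8: "exec (emits w1) (rev ?B @ hash # ?l, [], [hash], enc_vars ?vs, rev out1) (length w1)
        (rev ?B @ hash # ?l, [], [hash], enc_vars ?vs, rev w1 @ rev out1)"
      by (rule exec_emits)
    have 9: "exec rewind0 (rev ?B @ hash # ?l, [], [hash], enc_vars ?vs, rev w1 @ rev out1) (3 * N + 5)
        (hash # ?l, ?B, [hash], enc_vars ?vs, rev w1 @ rev out1)"
      by (rule exec_cong[OF exec_rewind0[of ?B "[]"]]) (use body in auto)
    let ?W = "concat (replicate (length Cs) w)"
    have 10: "exec (tally w) (hash # ?l, ?B, [hash], enc_vars ?vs, rev w1 @ rev out1)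
        (N * (length w + 5) + 1)
        (rev ?B @ hash # ?l, [], [hash], enc_vars ?vs, rev ?W @ rev w1 @ rev out1)"
      by (rule exec_cong[OF exec_tally]) (use body tally_enc_body[of w Cs] in \<open>auto intro!: mult_le_mono1\<close>)
    note 11 = exec_emits[of w2 "rev ?B @ hash # ?l" "[]" "[hash]" "enc_vars ?vs" "rev ?W @ rev w1 @ rev out1"]
    have "exec (reduction w1 w w2) ([], enc_formula (n, Cs), [], [], []) (poly P N)
        (rev ?B @ hash # ?l, [], [hash], enc_vars ?vs, rev (out1 @ w1 @ ?W @ w2))"
      unfolding reduction_def enc_formula_eq
      by (rule exec_cong[OF exec_Seq[OF 1 exec_Seq[OF 2 exec_Seq[OF 3 exec_Seq[OF 4 exec_Seq[OF 5
        exec_Seq[OF 6 exec_Seq[OF 7 exec_Seq[OF 8 exec_Seq[OF 9 exec_Seq[OF 10 11]]]]]]]]]]])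
        (simp_all add: P_def X_def c_def algebra_simps)
    then show ?thesis
      unfolding out1_def N_def by (rule exec_computes_within)
  qed
  then show ?thesis by (intro exI[of _ P]) auto
qed

section \<open>The gadget\<close>

lemma powr_le_one:
  assumes "\<bar>x\<bar> \<le> 1" "0 \<le> p"
  shows "\<bar>x::real\<bar> powr p \<le> 1"
  using powr_mono2[of p "\<bar>x\<bar>" 1] assms by simp

definition small_gadget :: "real \<Rightarrow> real \<Rightarrow> real \<Rightarrow> real \<Rightarrow> bool" where
  "small_gadget p d e f \<longleftrightarrow> 0 \<le> d + e + f \<and> d + e + f \<le> 2 \<and>
     \<bar>e + f - d\<bar> powr p + \<bar>d + f - e\<bar> powr p + \<bar>d + e - f\<bar> powr p \<le> 2 + (4/3) powr p"

definition rounds_up :: "real \<Rightarrow> real \<Rightarrow> real \<Rightarrow> real \<Rightarrow> bool" where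
  "rounds_up p a b c \<longleftrightarrow>
     (\<exists>x\<in>{0,1}. \<exists>y\<in>{0,1}. \<exists>z\<in>{0,1}. small_gadget p (a - x) (b - y) (c - z))"

text \<open>The asymmetric form suits sorted coordinates: the row that subtracts the middle one
  always stays within 1, and only one of the outer rows can need 4/3.\<close>

lemma small_gadgetI:
  assumes "1 \<le> p" "0 \<le> d + e + f" "d + e + f \<le> 2" "\<bar>d + f - e\<bar> \<le> 1"
    and "\<bar>e + f - d\<bar> \<le> 1 \<and> \<bar>d + e - f\<bar> \<le> 4/3 \<or> \<bar>e + f - d\<bar> \<le> 4/3 \<and> \<bar>d + e - f\<bar> \<le> 1"
  shows "small_gadget p d e f"
proof -
  have "\<bar>r\<bar> powr p \<le> (4/3) powr p" if "\<bar>r\<bar> \<le> 4/3" for r :: real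
    using that assms(1) by (intro powr_mono2) auto
  note large = this[of "e + f - d"] this[of "d + e - f"]
  have "\<bar>r\<bar> powr p \<le> 1" if "\<bar>r\<bar> \<le> 1" for r :: real
    using that assms(1) by (intro powr_le_one) auto
  note small = this[of "e + f - d"] this[of "d + e - f"] this[OF assms(4)]
  from assms(5) have "\<bar>e + f - d\<bar> powr p + \<bar>d + e - f\<bar> powr p \<le> 1 + (4/3) powr p"
  proof
    assume *: "\<bar>e + f - d\<bar> \<le> 1 \<and> \<bar>d + e - f\<bar> \<le> 4/3"
    from small(1) large(2) * show ?thesis by linarith
  next
    assume *: "\<bar>e + f - d\<bar> \<le> 4/3 \<and> \<bar>d + e - f\<bar> \<le> 1"
    from small(2) large(1) * show ?thesis by linarith
  qed
  with small(3) show ?thesis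
    using assms(2,3) unfolding small_gadget_def by linarith
qed

text \<open>
  With \<open>a \<ge> b \<ge> c\<close>, the rounding is 000 if \<open>a + b + c \<le> 2\<close> and \<open>a + b - c \<le> 4/3\<close>,
  110 if \<open>a + b + c > 2\<close>, and 100 otherwise.
\<close>

lemma rounds_up_sorted:
  assumes "0 \<le> c" "c \<le> b" "b \<le> a" "a \<le> 1" "1 \<le> p"
  shows "rounds_up p a b c"
proof -
  consider "a + b + c \<le> 2" "a + b - c \<le> 4/3" | "a + b + c \<le> 2" "4/3 < a + b - c" | "2 < a + b + c"
    by linarith
  then show ?thesis
  proof cases
    case 1
    then have "small_gadget p (a - 0) (b - 0) (c - 0)"
      using assms by (intro small_gadgetI) (auto simp: abs_le_iff)
    then show ?thesis unfolding rounds_up_def by blast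
  next
    case 2
    \<comment> \<open>Subtracting the two case conditions gives c < 1/3, and b \<le> a, so the first
      row b + c - a + 1 is at most 4/3.\<close>
    then have "small_gadget p (a - 1) (b - 0) (c - 0)"
      using assms by (intro small_gadgetI) (auto simp: abs_le_iff)
    then show ?thesis unfolding rounds_up_def by blast
  next
    case 3
    \<comment> \<open>The largest coordinate \<open>a\<close> exceeds 2/3 and b \<ge> c, so the last
      row a + b - c - 2 is at least -4/3.\<close>
    then have "small_gadget p (a - 1) (b - 1) (c - 0)"
      using assms by (intro small_gadgetI) (auto simp: abs_le_iff)
    then show ?thesis unfolding rounds_up_def by blast
  qed
qed

lemma rounds_up_swap12: "rounds_up p a b c \<Longrightarrow> rounds_up p b a c"
proof -
  have "small_gadget p d e f \<Longrightarrow> small_gadget p e d f" for d e f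
    by (simp add: small_gadget_def add.commute add.left_commute)
  then show "rounds_up p a b c \<Longrightarrow> rounds_up p b a c"
    unfolding rounds_up_def by blast
qed

lemma rounds_up_swap23: "rounds_up p a b c \<Longrightarrow> rounds_up p a c b"
proof -
  have "small_gadget p d e f \<Longrightarrow> small_gadget p d f e" for d e f
    by (simp add: small_gadget_def add.commute add.left_commute)
  then show "rounds_up p a b c \<Longrightarrow> rounds_up p a c b"
    unfolding rounds_up_def by blast
qed

lemma rounds_up:
  assumes "a \<in> {0..1}" "b \<in> {0..1}" "c \<in> {0..1}" "1 \<le> p"
  shows "rounds_up p a b c"
proof -
  consider "c \<le> b" "b \<le> a" | "b \<le> c" "c \<le> a" | "c \<le> a" "a \<le> b" | "a \<le> c" "c \<le> b"
    | "b \<le> a" "a \<le> c" | "a \<le> b" "b \<le> c" by linarith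
  then show ?thesis
  proof cases
    case 1
    then show ?thesis using assms by (intro rounds_up_sorted) auto
  next
    case 2
    then show ?thesis using assms by (intro rounds_up_swap23[OF rounds_up_sorted]) auto
  next
    case 3
    then show ?thesis using assms by (intro rounds_up_swap12[OF rounds_up_sorted]) auto
  next
    case 4
    then show ?thesis using assms
      by (intro rounds_up_swap12[OF rounds_up_swap23[OF rounds_up_sorted]]) auto
  next
    case 5
    then show ?thesis using assms
      by (intro rounds_up_swap23[OF rounds_up_swap12[OF rounds_up_sorted]]) auto
  next
    case 6
    then show ?thesis using assms
      by (intro rounds_up_swap12[OF rounds_up_swap23[OF rounds_up_swap12[OF rounds_up_sorted]]]) auto
  qed
qed

definition gsum :: "(nat \<Rightarrow> real) \<Rightarrow> real" where
  "gsum d = d 0 + d 1 + d 2"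

definition gcost :: "real \<Rightarrow> (nat \<Rightarrow> real) \<Rightarrow> real" where
  "gcost p d = (\<Sum>t<3. \<bar>gsum d - 2 * d t\<bar> powr p)"

lemma gcost_eq:
  "gcost p d = \<bar>d 1 + d 2 - d 0\<bar> powr p + \<bar>d 0 + d 2 - d 1\<bar> powr p + \<bar>d 0 + d 1 - d 2\<bar> powr p"
proof -
  have "gsum d - 2 * d 0 = d 1 + d 2 - d 0" "gsum d - 2 * d 1 = d 0 + d 2 - d 1"
    "gsum d - 2 * d 2 = d 0 + d 1 - d 2"
    by (simp_all add: gsum_def)
  then show ?thesis
    by (simp add: gcost_def numeral_3_eq_3 numeral_2_eq_2)
qed

lemma small_gadget_iff:
  "small_gadget p (d 0) (d 1) (d 2) \<longleftrightarrow> 0 \<le> gsum d \<and> gsum d \<le> 2 \<and> gcost p d \<le> 2 + (4/3) powr p"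
  by (simp only: small_gadget_def gcost_eq gsum_def)

lemma gsum_minus: "gsum (\<lambda>j. - d j) = - gsum d"
  by (simp add: gsum_def)

lemma gcost_minus: "gcost p (\<lambda>j. - d j) = gcost p d"
proof -
  have "gsum (\<lambda>j. - d j) - 2 * - d t = - (gsum d - 2 * d t)" for t
    by (simp add: gsum_minus)
  then show ?thesis
    unfolding gcost_def by (simp only: abs_minus_cancel)
qed

text \<open>The negative sign is reduced to the positive one by the reflection of the cube:
  replacing \<open>w\<close> and \<open>x\<close> by \<open>1 - w\<close> and \<open>1 - x\<close>
  negates the displacement, and the gadget cost is even.\<close>

lemma gadget_rounding:
  assumes "\<And>j. j < 3 \<Longrightarrow> 0 \<le> w j \<and> w j \<le> 1" "1 \<le> p"
  obtains x where "\<forall>j. x j \<in> {0, 1}"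
    "if \<tau> then 0 \<le> gsum (\<lambda>j. w j - x j) \<and> gsum (\<lambda>j. w j - x j) \<le> 2
     else -2 \<le> gsum (\<lambda>j. w j - x j) \<and> gsum (\<lambda>j. w j - x j) \<le> 0"
    "gcost p (\<lambda>j. w j - x j) \<le> 2 + (4/3) powr p"
proof -
  have up: "\<exists>x. (\<forall>j. x j \<in> {0, 1}) \<and> 0 \<le> gsum (\<lambda>j. u j - x j) \<and> gsum (\<lambda>j. u j - x j) \<le> 2 \<and>
      gcost p (\<lambda>j. u j - x j) \<le> 2 + (4/3) powr p"
    if u: "\<And>j. j < 3 \<Longrightarrow> 0 \<le> u j \<and> u j \<le> 1" for u
  proof -
    have "rounds_up p (u 0) (u 1) (u 2)"
      using u assms(2) by (intro rounds_up) auto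
    then obtain x y z where xyz: "x \<in> {0,1}" "y \<in> {0,1}" "z \<in> {0,1}"
      and small: "small_gadget p (u 0 - x) (u 1 - y) (u 2 - z)"
      unfolding rounds_up_def by blast
    define X where "X j = (if j = 0 then x else if j = 1 then y else z)" for j :: nat
    have X: "X 0 = x" "X 1 = y" "X 2 = z" by (simp_all add: X_def)
    have binary: "\<forall>j. X j \<in> {0, 1}" using xyz unfolding X_def by simp
    have "small_gadget p (u 0 - X 0) (u 1 - X 1) (u 2 - X 2)"
      unfolding X by (rule small)
    then have "0 \<le> gsum (\<lambda>j. u j - X j) \<and> gsum (\<lambda>j. u j - X j) \<le> 2 \<and>
        gcost p (\<lambda>j. u j - X j) \<le> 2 + (4/3) powr p"
      unfolding small_gadget_iff[of p "\<lambda>j. u j - X j"] .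
    with binary show ?thesis
      by (intro exI[of _ X]) simp
  qed
  show ?thesis
  proof (cases \<tau>)
    case True
    obtain x where "\<forall>j. x j \<in> {0, 1::real}" "0 \<le> gsum (\<lambda>j. w j - x j)"
      "gsum (\<lambda>j. w j - x j) \<le> 2" "gcost p (\<lambda>j. w j - x j) \<le> 2 + (4/3) powr p"
      using up[of w, OF assms(1)] by blast
    then show ?thesis using True by (intro that[of x]) simp_all
  next
    case False
    have "0 \<le> 1 - w j \<and> 1 - w j \<le> 1" if "j < 3" for j
      using assms(1)[OF that] by simp
    from up[of "\<lambda>j. 1 - w j", OF this] obtain x where x: "\<forall>j. x j \<in> {0, 1::real}"
      "0 \<le> gsum (\<lambda>j. (1 - w j) - x j)" "gsum (\<lambda>j. (1 - w j) - x j) \<le> 2"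
      "gcost p (\<lambda>j. (1 - w j) - x j) \<le> 2 + (4/3) powr p"
      by blast
    have flip: "(\<lambda>j. w j - (1 - x j)) = (\<lambda>j. - ((1 - w j) - x j))"
      by auto
    show ?thesis
    proof (rule that[of "\<lambda>j. 1 - x j"])
      show "\<forall>j. 1 - x j \<in> {0, 1}" using x(1) by auto
      show "gcost p (\<lambda>j. w j - (1 - x j)) \<le> 2 + (4/3) powr p"
        unfolding flip gcost_minus by (rule x(4))
      show "if \<tau> then 0 \<le> gsum (\<lambda>j. w j - (1 - x j)) \<and> gsum (\<lambda>j. w j - (1 - x j)) \<le> 2
        else -2 \<le> gsum (\<lambda>j. w j - (1 - x j)) \<and> gsum (\<lambda>j. w j - (1 - x j)) \<le> 0"
        unfolding flip gsum_minus using x(2,3) False by simp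
    qed
  qed
qed

text \<open>
  At the center all three gadget values are odd multiples of 1/2. Cond all of them are \<open>\<plusminus>1/2\<close>, the
  three coordinates agree and are binary; otherwise one of them is at least 3/2 in absolute value.
\<close>

lemma gadget_at_center:
  assumes "\<And>j. j < 3 \<Longrightarrow> x j \<in> \<int>" "0 \<le> p"
  defines "d \<equiv> \<lambda>j. 1/2 - x j"
  shows "\<bar>gsum d\<bar> = 3/2 \<and> 3 * (1/2) powr p \<le> gcost p d \<or>
    (3/2) powr p + 2 * (1/2) powr p \<le> gcost p d"
proof -
  have "x 0 \<in> \<int>" "x 1 \<in> \<int>" "x 2 \<in> \<int>"
    using assms(1) by simp_all
  then obtain i j k where x: "x 0 = of_int i" "x 1 = of_int j" "x 2 = of_int k"
    unfolding Ints_def by blast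
  define r where "r t = gsum d - 2 * d t" for t
  define n where "n = (\<lambda>t::nat. if t = 0 then i - j - k else if t = 1 then j - i - k else k - i - j)"
  have r: "r t = 1/2 + of_int (n t)" if "t \<in> {0, 1, 2}" for t
    using that x by (auto simp: r_def n_def gsum_def d_def)
  have cost: "gcost p d = \<bar>r 0\<bar> powr p + \<bar>r 1\<bar> powr p + \<bar>r 2\<bar> powr p"
    by (simp add: gcost_def r_def eval_nat_numeral)
  have half: "(1/2) powr p \<le> \<bar>r t\<bar> powr p" if "t \<in> {0, 1, 2}" for t
  proof -
    have "n t \<ge> 0 \<or> n t \<le> -1" by linarith
    then have "1/2 \<le> \<bar>r t\<bar>" using r[OF that] by (auto simp: abs_if)
    then show ?thesis using assms(2) by (intro powr_mono2) auto
  qed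
  show ?thesis
  proof (cases "\<exists>t\<in>{0,1,2}. n t \<notin> {0, -1}")
    case True
    then obtain t where t: "t \<in> {0,1,2}" "n t \<notin> {0, -1}" by blast
    then have "n t \<ge> 1 \<or> n t \<le> -2" by auto
    then have "3/2 \<le> \<bar>r t\<bar>" using r[OF t(1)] by (auto simp: abs_if)
    then have "(3/2) powr p \<le> \<bar>r t\<bar> powr p" using assms(2) by (intro powr_mono2) auto
    then show ?thesis using t(1) cost half[of 0] half[of 1] half[of 2] by auto
  next
    case False
    then have "i - j - k \<in> {0,-1}" "j - i - k \<in> {0,-1}" "k - i - j \<in> {0,-1}"
      by (auto simp: n_def split: if_splits)
    \<comment> \<open>Adding two of the three values gives minus twice one of the integers, so each
      integer is 0 or 1; a mixed triple would produce the value 1 or -2.\<close>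
    then have "i = j" "j = k" "k \<in> {0, 1}" by auto
    then have "\<bar>gsum d\<bar> = 3/2" using x by (auto simp: gsum_def d_def)
    then show ?thesis using cost half[of 0] half[of 1] half[of 2] by auto
  qed
qed

section \<open>The cost of a clause\<close>

definition lit_term :: "(nat \<Rightarrow> nat \<Rightarrow> real) \<Rightarrow> literal \<Rightarrow> real" where
  "lit_term D l = of_int (lit_sign l) * gsum (D (lit_var l)) / 3"

definition clause_cost :: "real \<Rightarrow> (nat \<Rightarrow> nat \<Rightarrow> real) \<Rightarrow> clause \<Rightarrow> real" where
  "clause_cost p D C = \<bar>\<Sum>l\<leftarrow>C. lit_term D l\<bar> powr p + (\<Sum>l\<leftarrow>C. gcost p (D (lit_var l)))"

lemma list_of_length_3:
  assumes "length C = 3"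
  obtains a b c where "C = [a, b, c]"
  using assms by (auto simp: eval_nat_numeral length_Suc_conv)

lemma nae_sat_3:
  "nae_sat \<sigma> [a, b, c] \<longleftrightarrow> \<not> (lit_val \<sigma> a = lit_val \<sigma> b \<and> lit_val \<sigma> b = lit_val \<sigma> c)"
  by (auto simp: nae_sat_def)

text \<open>Each variable is rounded with the sign that the assignment gives it, so true literals
  contribute a value in [0, 2/3] and false ones a value in [-2/3, 0]. If both kinds occur in a
  clause, at most two terms add up with the same sign, which gives 4/3 instead of 2. The rounding of
  a variable does not depend on the clause.\<close>

lemma clause_cost_upper:
  assumes W: "\<And>v j. v \<in> V \<Longrightarrow> j < 3 \<Longrightarrow> 0 \<le> W v j \<and> W v j \<le> 1" and p: "1 \<le> p"
  obtains X where "\<forall>v j. X v j \<in> {0, 1}"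
    "\<forall>C. length C = 3 \<longrightarrow> lit_var ` set C \<subseteq> V \<longrightarrow> clause_cost p (\<lambda>v j. W v j - X v j) C \<le>
       (if nae_sat \<sigma> C then (4/3) powr p else 2 powr p) + 3 * (2 + (4/3) powr p)"
proof -
  define rounded where "rounded v x \<longleftrightarrow> (\<forall>j. x j \<in> {0, 1::real}) \<and> (v \<in> V \<longrightarrow>
    (if \<sigma> v then 0 \<le> gsum (\<lambda>j. W v j - x j) \<and> gsum (\<lambda>j. W v j - x j) \<le> 2
     else -2 \<le> gsum (\<lambda>j. W v j - x j) \<and> gsum (\<lambda>j. W v j - x j) \<le> 0) \<and>
    gcost p (\<lambda>j. W v j - x j) \<le> 2 + (4/3) powr p)" for v x
  have "\<exists>x. rounded v x" for v
  proof (cases "v \<in> V")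
    case True
    obtain x where "\<forall>j. x j \<in> {0, 1}"
      "if \<sigma> v then 0 \<le> gsum (\<lambda>j. W v j - x j) \<and> gsum (\<lambda>j. W v j - x j) \<le> 2
       else -2 \<le> gsum (\<lambda>j. W v j - x j) \<and> gsum (\<lambda>j. W v j - x j) \<le> 0"
      "gcost p (\<lambda>j. W v j - x j) \<le> 2 + (4/3) powr p"
      by (rule gadget_rounding[where \<tau> = "\<sigma> v", OF W[OF True] p])
    then show ?thesis unfolding rounded_def by blast
  next
    case False
    \<comment> \<open>Outside \<open>V\<close> a rounded point only has to be binary; zero is a
      default.\<close>
    then show ?thesis unfolding rounded_def by (intro exI[of _ "\<lambda>_. 0"]) simp
  qed
  then have "\<forall>v. \<exists>x. rounded v x" by blast
  from choice[OF this] obtain X where "\<forall>v. rounded v (X v)" by blast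
  then have X: "\<And>v j. X v j \<in> {0, 1}"
    and sum: "\<And>v. v \<in> V \<Longrightarrow> if \<sigma> v then 0 \<le> gsum (\<lambda>j. W v j - X v j) \<and> gsum (\<lambda>j. W v j - X v j) \<le> 2
     else -2 \<le> gsum (\<lambda>j. W v j - X v j) \<and> gsum (\<lambda>j. W v j - X v j) \<le> 0"
    and cost: "\<And>v. v \<in> V \<Longrightarrow> gcost p (\<lambda>j. W v j - X v j) \<le> 2 + (4/3) powr p"
    unfolding rounded_def by blast+
  define D where "D = (\<lambda>v j. W v j - X v j)"
  have lit: "if lit_val \<sigma> l then 0 \<le> lit_term D l \<and> lit_term D l \<le> 2/3
      else -2/3 \<le> lit_term D l \<and> lit_term D l \<le> 0" if "lit_var l \<in> V" for l
    using sum[OF that] by (cases l) (auto simp: lit_term_def D_def split: if_splits)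
  have "clause_cost p D C \<le> (if nae_sat \<sigma> C then (4/3) powr p else 2 powr p) + 3 * (2 + (4/3) powr p)"
    if C: "length C = 3" "lit_var ` set C \<subseteq> V" for C
  proof -
    obtain a b c where abc: "C = [a, b, c]" using C(1) by (rule list_of_length_3)
    have V: "lit_var a \<in> V" "lit_var b \<in> V" "lit_var c \<in> V" using C(2) abc by auto
    let ?s = "lit_term D a + lit_term D b + lit_term D c"
    have "\<bar>?s\<bar> \<le> (if nae_sat \<sigma> C then 4/3 else 2)"
      using lit[OF V(1)] lit[OF V(2)] lit[OF V(3)] unfolding abc nae_sat_3
      by (auto simp: abs_le_iff split: if_splits)
    then have "\<bar>?s\<bar> powr p \<le> (if nae_sat \<sigma> C then 4/3 else 2) powr p"
      using p by (intro powr_mono2) auto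
    moreover have "gcost p (D (lit_var a)) \<le> 2 + (4/3) powr p"
      "gcost p (D (lit_var b)) \<le> 2 + (4/3) powr p" "gcost p (D (lit_var c)) \<le> 2 + (4/3) powr p"
      using cost V by (simp_all add: D_def)
    ultimately show ?thesis
      by (simp add: clause_cost_def abc add.assoc split: if_splits)
  qed
  with X show ?thesis unfolding D_def by (intro that[of X]) simp_all
qed

text \<open>
  A variable that is not rounded consistently saves at most \<open>(3/2) powr p\<close> in a clause row, but each
  of its occurrences pays \<open>(3/2) powr p - (1/2) powr p\<close> in the gadget. The signs of the gadget sums
  define the assignment, so the three terms of an unsatisfied clause never cancel.
\<close>

lemma clause_cost_lower:
  assumes X: "\<And>v j. v \<in> V \<Longrightarrow> j < 3 \<Longrightarrow> X v j \<in> \<int>" and p: "1 \<le> p"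
  defines "D \<equiv> \<lambda>v j. 1/2 - X v j"
  defines "\<sigma> \<equiv> \<lambda>v. 0 < gsum (D v)"
  assumes C: "length C = 3" "lit_var ` set C \<subseteq> V"
  shows "(if nae_sat \<sigma> C then 10 / 2 powr p else (3/2) powr p + 9 / 2 powr p) \<le> clause_cost p D C"
proof -
  define h t where "h = (1/2::real) powr p" and "t = (3/2::real) powr p"
  have h: "1 / 2 powr p = h" by (simp add: h_def powr_divide)
  \<comment> \<open>The aim is 3h \<le> t: an inconsistent gadget, paying t + 2h, is never cheaper
    than a consistent one, paying 3h.\<close>
  have "3 powr 1 \<le> (3::real) powr p" using p by (intro powr_mono) auto
  then have "3 * h \<le> 3 powr p * h" by (simp add: h_def)
  also have "3 powr p * h = t" by (simp add: h_def t_def powr_divide)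
  finally have t: "3 * h \<le> t" .
  have h0: "0 \<le> h" by (simp add: h_def)
  obtain a b c where abc: "C = [a, b, c]" using C(1) by (rule list_of_length_3)
  define g where "g l = gcost p (D (lit_var l))" for l
  define z where "z l = lit_term D l" for l
  have gad: "\<bar>z l\<bar> = 1/2 \<and> 3 * h \<le> g l \<or> t + 2 * h \<le> g l" if "l \<in> {a, b, c}" for l
  proof -
    have "lit_var l \<in> V" using that C(2) abc by auto
    then have "\<bar>gsum (D (lit_var l))\<bar> = 3/2 \<and> 3 * h \<le> g l \<or> t + 2 * h \<le> g l"
      using gadget_at_center[of "X (lit_var l)" p] X p by (simp add: D_def g_def h_def t_def)
    moreover have "\<bar>z l\<bar> = \<bar>gsum (D (lit_var l))\<bar> / 3"
      by (cases l) (auto simp: z_def lit_term_def)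
    ultimately show ?thesis by auto
  qed
  \<comment> \<open>A gadget sum of zero makes the variable false, but the weak inequalities hold
    for it with either sign.\<close>
  have sgn: "if lit_val \<sigma> l then 0 \<le> z l else z l \<le> 0" for l
    by (cases l) (auto simp: z_def lit_term_def \<sigma>_def)
  define s where "s = \<bar>z a + z b + z c\<bar>"
  have s0: "0 \<le> s powr p" by simp
  have s1: "1/2 \<le> s \<Longrightarrow> h \<le> s powr p" and s2: "3/2 \<le> s \<Longrightarrow> t \<le> s powr p"
    unfolding h_def t_def using p by (auto intro!: powr_mono2)
  have cost: "clause_cost p D C = s powr p + g a + g b + g c"
    by (simp add: clause_cost_def abc s_def z_def g_def add.assoc)
  have ga: "\<bar>z a\<bar> = 1/2 \<and> 3 * h \<le> g a \<or> t + 2 * h \<le> g a"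
    and gb: "\<bar>z b\<bar> = 1/2 \<and> 3 * h \<le> g b \<or> t + 2 * h \<le> g b"
    and gc: "\<bar>z c\<bar> = 1/2 \<and> 3 * h \<le> g c \<or> t + 2 * h \<le> g c"
    using gad by auto
  have g3: "3 * h \<le> g a" "3 * h \<le> g b" "3 * h \<le> g c"
    using ga gb gc t h0 by auto
  let ?a = "\<bar>z a\<bar> = 1/2" and ?b = "\<bar>z b\<bar> = 1/2" and ?c = "\<bar>z c\<bar> = 1/2"
  have "(if nae_sat \<sigma> C then 10 * h else t + 9 * h) \<le> s powr p + g a + g b + g c"
  proof (cases "nae_sat \<sigma> C")
    case True
    have "10 * h \<le> s powr p + g a + g b + g c"
    proof (cases "?a \<and> ?b \<and> ?c")
      case True
      \<comment> \<open>A sum of three terms \<plusminus>1/2 is an odd multiple of 1/2 and cannot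
        vanish.\<close>
      then have "1/2 \<le> s" by (auto simp: s_def abs_if split: if_splits)
      from s1[OF this] g3 show ?thesis by linarith
    next
      case False
      then have "t + 2 * h \<le> g a \<or> t + 2 * h \<le> g b \<or> t + 2 * h \<le> g c"
        using ga gb gc by blast
      \<comment> \<open>One inconsistent gadget suffices even if the clause row is zero: (t + 2h) +
        3h + 3h \<ge> 11h.\<close>
      then show ?thesis by (elim disjE conjE) (use g3 t h0 s0 in linarith)+
    qed
    then show ?thesis using True by simp
  next
    case False
    then have s: "s = \<bar>z a\<bar> + \<bar>z b\<bar> + \<bar>z c\<bar>"
      using sgn[of a] sgn[of b] sgn[of c] unfolding abc nae_sat_3 s_def
      by (auto split: if_splits)
    consider "?a" "?b" "?c" | "?a \<and> ?b \<or> ?a \<and> ?c \<or> ?b \<and> ?c"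
        "t + 2 * h \<le> g a \<or> t + 2 * h \<le> g b \<or> t + 2 * h \<le> g c"
      | "t + 2 * h \<le> g a \<and> t + 2 * h \<le> g b \<or> t + 2 * h \<le> g a \<and> t + 2 * h \<le> g c \<or>
         t + 2 * h \<le> g b \<and> t + 2 * h \<le> g c"
      using ga gb gc by blast
    then have "t + 9 * h \<le> s powr p + g a + g b + g c"
    proof cases
      case 1
      then have "3/2 \<le> s" using s by simp
      from s2[OF this] g3 show ?thesis by linarith
    next
      case 2
      \<comment> \<open>With a single inconsistent gadget the bound is met exactly: h + (t + 2h) +
        3h + 3h = t + 9h. The clause row has to supply the \<open>h\<close>, and it does, since its
        terms do not cancel.\<close>
      then have "1/2 \<le> s" using s by auto
      from s1[OF this] 2(2) g3 show ?thesis by auto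
    next
      case 3
      \<comment> \<open>Two inconsistent gadgets make the clause row irrelevant: 2(t + 2h) + 3h = 2t
        + 7h \<ge> t + 10h.\<close>
      then show ?thesis by (elim disjE conjE) (use g3 t h0 s0 in linarith)+
    qed
    then show ?thesis using False by simp
  qed
  moreover have "10 / 2 powr p = 10 * h" "9 / 2 powr p = 9 * h"
    using arg_cong[OF h, of "\<lambda>x. 10 * x"] arg_cong[OF h, of "\<lambda>x. 9 * x"] by simp_all
  ultimately show ?thesis
    unfolding cost t_def[symmetric] by (cases "nae_sat \<sigma> C") auto
qed

section \<open>The matrix\<close>

text \<open>The coordinates are a total function rather than a vector, so cutting a row into blocks
  of columns merely shifts arguments.\<close>

definition row_val :: "rat list \<Rightarrow> (nat \<Rightarrow> real) \<Rightarrow> real" where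
  "row_val q d = (\<Sum>j<length q. of_rat (q ! j) * d j)"

lemma row_val_Nil [simp]: "row_val [] d = 0"
  by (simp add: row_val_def)

lemma row_val_Cons [simp]: "row_val (a # q) d = of_rat a * d 0 + row_val q (\<lambda>j. d (Suc j))"
  by (simp add: row_val_def sum.lessThan_Suc_shift del: sum.lessThan_Suc)

lemma row_val_append: "row_val (q @ q') d = row_val q d + row_val q' (\<lambda>j. d (length q + j))"
  by (induction q arbitrary: d) auto

lemma row_val_concat:
  assumes "\<And>v. length (g v) = 3"
  shows "row_val (concat (map g vs)) d = (\<Sum>a<length vs. row_val (g (vs ! a)) (\<lambda>j. d (3 * a + j)))"
  by (induction vs arbitrary: d)
    (auto simp: assms row_val_append sum.lessThan_Suc_shift add.assoc[symmetric] add.commute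
      simp del: sum.lessThan_Suc)

definition var_index :: "nat list \<Rightarrow> nat \<Rightarrow> nat" where
  "var_index vs v = inv_into {..<length vs} ((!) vs) v"

lemma var_index:
  assumes "v \<in> set vs"
  shows "var_index vs v < length vs" "vs ! var_index vs v = v"
proof -
  have v: "v \<in> (!) vs ` {..<length vs}"
    using assms by (auto simp: in_set_conv_nth)
  show "var_index vs v < length vs" "vs ! var_index vs v = v"
    using inv_into_into[OF v] f_inv_into_f[OF v] by (auto simp: var_index_def)
qed

lemma var_index_nth:
  assumes "distinct vs" "a < length vs"
  shows "var_index vs (vs ! a) = a"
  unfolding var_index_def using assms by (intro inv_into_f_f) (auto simp: inj_on_def nth_eq_iff_index_eq)

definition var_coords :: "nat list \<Rightarrow> (nat \<Rightarrow> real) \<Rightarrow> nat \<Rightarrow> nat \<Rightarrow> real" where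
  "var_coords vs d v j = d (3 * var_index vs v + j)"

lemma row_val_vars:
  assumes "distinct vs" "\<And>v. length (g v) = 3"
  shows "row_val (concat (map g vs)) d = (\<Sum>v\<in>set vs. row_val (g v) (var_coords vs d v))"
proof -
  have "row_val (concat (map g vs)) d = (\<Sum>a<length vs. row_val (g (vs ! a)) (var_coords vs d (vs ! a)))"
    unfolding row_val_concat[of g, OF assms(2)]
    by (intro sum.cong refl) (simp add: var_coords_def[abs_def] var_index_nth assms(1))
  also have "\<dots> = (\<Sum>v\<in>set vs. row_val (g v) (var_coords vs d v))"
    by (rule sum.reindex_bij_betw[OF bij_betw_nth[OF assms(1)]]) auto
  finally show ?thesis .
qed

lemma row_val_gadget:
  assumes "t < 3"
  shows "row_val (gadget t) d = gsum d - 2 * d t"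
proof -
  have "t = 0 \<or> t = 1 \<or> t = 2" using assms by auto
  then show ?thesis
    by (auto simp: gadget_def gsum_def numeral_3_eq_3 numeral_2_eq_2 of_rat_minus)
qed

lemma row_val_gadget_row:
  assumes "distinct vs" "lit_var l \<in> set vs" "t < 3"
  shows "row_val (gadget_row vs l t) d =
    gsum (var_coords vs d (lit_var l)) - 2 * var_coords vs d (lit_var l) t"
proof -
  have "row_val (gadget_row vs l t) d =
      (\<Sum>v\<in>set vs. row_val (if lit_var l = v then gadget t else [0, 0, 0]) (var_coords vs d v))"
    unfolding gadget_row_def by (rule row_val_vars[OF assms(1)]) (simp add: gadget_def)
  also have "\<dots> = (\<Sum>v\<in>set vs. if lit_var l = v then row_val (gadget t) (var_coords vs d v) else 0)"
    by (intro sum.cong) auto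
  also have "\<dots> = row_val (gadget t) (var_coords vs d (lit_var l))"
    using assms(2) by simp
  finally show ?thesis using row_val_gadget[OF assms(3)] by simp
qed

text \<open>A variable can occur in a clause with both signs, where its coefficient becomes 0.
  Summing the signs per variable and then over the variables still yields the signed sum over the
  literals, which is the form used in the cost estimates.\<close>

lemma sum_clause_coeff:
  assumes "lit_var ` set C \<subseteq> V" "finite V"
  shows "(\<Sum>v\<in>V. of_int (clause_coeff C v) * gsum (D v) / 3) = (\<Sum>l\<leftarrow>C. lit_term D l)"
  using assms(1)
proof (induction C)
  case Nil
  then show ?case by (simp add: clause_coeff_def)
next
  case (Cons l C)
  have "(\<Sum>v\<in>V. of_int (clause_coeff (l # C) v) * gsum (D v) / 3) =
      (\<Sum>v\<in>V. (if lit_var l = v then of_int (lit_sign l) * gsum (D v) / 3 else 0) +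
        of_int (clause_coeff C v) * gsum (D v) / 3)"
    by (intro sum.cong) (auto simp: clause_coeff_def field_simps)
  then show ?case
    using Cons assms(2) by (simp add: sum.distrib lit_term_def)
qed

lemma row_val_clause_row:
  assumes "distinct vs" "lit_var ` set C \<subseteq> set vs"
  shows "row_val (clause_row vs C) d = (\<Sum>l\<leftarrow>C. lit_term (var_coords vs d) l)"
proof -
  have "row_val (clause_row vs C) d =
      (\<Sum>v\<in>set vs. row_val (replicate 3 (of_int (clause_coeff C v) / 3)) (var_coords vs d v))"
    unfolding clause_row_def by (rule row_val_vars[OF assms(1)]) simp
  also have "\<dots> = (\<Sum>v\<in>set vs. of_int (clause_coeff C v) * gsum (var_coords vs d v) / 3)"
    by (intro sum.cong refl) (simp add: numeral_3_eq_3 gsum_def numeral_2_eq_2 of_rat_divide field_simps)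
  also have "\<dots> = (\<Sum>l\<leftarrow>C. lit_term (var_coords vs d) l)"
    using assms(2) by (rule sum_clause_coeff) simp
  finally show ?thesis .
qed

lemma sum_clause_rows:
  assumes "distinct vs" "lit_var ` set C \<subseteq> set vs"
  shows "(\<Sum>q\<leftarrow>clause_rows vs C. \<bar>row_val q d\<bar> powr p) = clause_cost p (var_coords vs d) C"
proof -
  have lit: "(\<Sum>q\<leftarrow>literal_rows vs l. \<bar>row_val q d\<bar> powr p) = gcost p (var_coords vs d (lit_var l))"
    if "lit_var l \<in> set vs" for l
    unfolding gcost_def using that assms(1)
    by (auto simp: literal_rows_def o_def interv_sum_list_conv_sum_set_nat row_val_gadget_row
        atLeast0LessThan intro!: sum.cong)
  have "(\<Sum>q\<leftarrow>concat (map (literal_rows vs) C). \<bar>row_val q d\<bar> powr p) =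
      (\<Sum>l\<leftarrow>C. gcost p (var_coords vs d (lit_var l)))"
    using assms(2) lit by (induction C) auto
  then show ?thesis
    using row_val_clause_row[OF assms] by (simp add: clause_rows_def clause_cost_def)
qed

lemma sum_matrix_rows:
  assumes "distinct vs" "set (clause_vars Cs) \<subseteq> set vs"
  shows "(\<Sum>q\<leftarrow>matrix_rows vs Cs. \<bar>row_val q d\<bar> powr p) =
    (\<Sum>C\<leftarrow>Cs. clause_cost p (var_coords vs d) C)"
  using assms(2) sum_clause_rows[OF assms(1)]
  by (induction Cs) (auto simp: matrix_rows_def)

lemma length_matrix_rows:
  assumes "q \<in> set (matrix_rows vs Cs)"
  shows "length q = 3 * length vs"
proof -
  have "length (concat (map g vs)) = 3 * length vs" if "\<And>v. length (g v) = 3" for g :: "nat \<Rightarrow> rat list"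
    using that by (induction vs) auto
  then show ?thesis
    using assms
    by (auto simp: matrix_rows_def clause_rows_def clause_row_def literal_rows_def gadget_row_def gadget_def)
qed

section \<open>The matrix, its norm and its rank\<close>

definition crp_matrix :: "clause list \<Rightarrow> rat mat" where
  "crp_matrix Cs = (let vs = used_vars Cs; R = matrix_rows vs Cs in
     mat (length R) (3 * length vs) (\<lambda>(i, j). R ! i ! j))"

lemma crp_matrix_carrier:
  "crp_matrix Cs \<in> carrier_mat (length (matrix_rows (used_vars Cs) Cs)) (3 * length (used_vars Cs))"
  by (simp add: crp_matrix_def Let_def)

lemma dim_crp_matrix [simp]:
  "dim_row (crp_matrix Cs) = length (matrix_rows (used_vars Cs) Cs)"
  "dim_col (crp_matrix Cs) = 3 * length (used_vars Cs)"
  using crp_matrix_carrier by auto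

lemma enc_mat_crp_matrix: "enc_mat (crp_matrix Cs) = enc_rows (matrix_rows (used_vars Cs) Cs)"
proof -
  let ?R = "matrix_rows (used_vars Cs) Cs" and ?k = "3 * length (used_vars Cs)"
  have "concat (map (\<lambda>j. enc_rat (crp_matrix Cs $$ (i, j)) @ '','') [0..<?k]) @ '';'' = enc_row (?R ! i)"
    if "i < length ?R" for i
  proof -
    have "length (?R ! i) = ?k" using length_matrix_rows[OF nth_mem[OF that]] .
    then have "map (\<lambda>j. enc_rat (crp_matrix Cs $$ (i, j)) @ '','') [0..<?k] =
        map (\<lambda>q. enc_rat q @ '','') (?R ! i)"
      using that by (intro nth_equalityI) (auto simp: crp_matrix_def Let_def)
    then show ?thesis by (simp add: enc_row_def enc_entries_def)
  qed
  then have "map (\<lambda>i. concat (map (\<lambda>j. enc_rat (crp_matrix Cs $$ (i, j)) @ '','') [0..<?k]) @ '';'')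
      [0..<length ?R] = map enc_row ?R"
    by (intro nth_equalityI) auto
  then show ?thesis by (simp add: enc_mat_def enc_rows_def)
qed

lemma crp_matrix_mult:
  assumes "d \<in> carrier_vec (3 * length (used_vars Cs))" "i < length (matrix_rows (used_vars Cs) Cs)"
  shows "(real_mat (crp_matrix Cs) *\<^sub>v d) $ i = row_val (matrix_rows (used_vars Cs) Cs ! i) (\<lambda>j. d $ j)"
proof -
  have "length (matrix_rows (used_vars Cs) Cs ! i) = 3 * length (used_vars Cs)"
    using length_matrix_rows[OF nth_mem[OF assms(2)]] .
  then show ?thesis
    using assms
    by (auto simp: scalar_prod_def row_val_def crp_matrix_def Let_def atLeast0LessThan intro!: sum.cong)
qed

lemma pnorm_crp_matrix:
  assumes "d \<in> carrier_vec (3 * length (used_vars Cs))"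
  shows "pnorm p (real_mat (crp_matrix Cs) *\<^sub>v d) =
    (\<Sum>C\<leftarrow>Cs. clause_cost p (var_coords (used_vars Cs) (\<lambda>j. d $ j)) C) powr (1 / p)"
proof -
  let ?R = "matrix_rows (used_vars Cs) Cs"
  have "(\<Sum>i<dim_vec (real_mat (crp_matrix Cs) *\<^sub>v d). \<bar>(real_mat (crp_matrix Cs) *\<^sub>v d) $ i\<bar> powr p) =
      (\<Sum>i<length ?R. \<bar>row_val (?R ! i) (\<lambda>j. d $ j)\<bar> powr p)"
    using crp_matrix_mult[OF assms] by (intro sum.cong) auto
  also have "\<dots> = (\<Sum>q\<leftarrow>?R. \<bar>row_val q (\<lambda>j. d $ j)\<bar> powr p)"
    by (simp add: sum_list_sum_nth atLeast0LessThan)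
  also have "\<dots> = (\<Sum>C\<leftarrow>Cs. clause_cost p (var_coords (used_vars Cs) (\<lambda>j. d $ j)) C)"
    by (rule sum_matrix_rows) (simp_all add: distinct_used_vars)
  finally show ?thesis by (simp add: pnorm_def)
qed

text \<open>Linear independence speaks about the set of columns, so repeated columns have to be
  excluded first: two equal ones would put a difference of unit vectors into the kernel.\<close>

lemma full_column_rank_if_kernel_trivial:
  fixes A :: "real mat"
  assumes "\<And>v. v \<in> carrier_vec (dim_col A) \<Longrightarrow> A *\<^sub>v v = 0\<^sub>v (dim_row A) \<Longrightarrow> v = 0\<^sub>v (dim_col A)"
  shows "full_column_rank A"
proof -
  interpret vec_space "TYPE(real)" "dim_row A" .
  have A: "A \<in> carrier_mat (dim_row A) (dim_col A)" by simp
  have "distinct (cols A)"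
  proof (rule ccontr)
    assume "\<not> distinct (cols A)"
    then obtain i j where ij: "i \<noteq> j" "i < dim_col A" "j < dim_col A" "col A i = col A j"
      by (auto simp: distinct_conv_nth)
    let ?v = "unit_vec (dim_col A) i - unit_vec (dim_col A) j :: real vec"
    have "A *\<^sub>v ?v = A *\<^sub>v unit_vec (dim_col A) i - A *\<^sub>v unit_vec (dim_col A) j"
      by (rule mult_minus_distrib_mat_vec[OF A]) auto
    also have "\<dots> = col A i - col A j"
    proof -
      have "A *\<^sub>v unit_vec (dim_col A) k = col A k" if "k < dim_col A" for k
        using that by (intro eq_vecI) auto
      then show ?thesis using ij by simp
    qed
    also have "\<dots> = 0\<^sub>v (dim_row A)"
      using ij by simp
    finally have "?v = 0\<^sub>v (dim_col A)" by (intro assms) auto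
    then have "?v $ i = 0\<^sub>v (dim_col A) $ i" by (rule arg_cong)
    then show False using ij by simp
  qed
  moreover have "lin_indpt (set (cols A))"
    using lin_depE[OF A _ \<open>distinct (cols A)\<close>] assms by metis
  ultimately show ?thesis
    unfolding full_column_rank_def using lin_indpt_full_rank[OF A] by blast
qed

text \<open>The gadget rows of a variable alone determine its three coordinates, and every listed
  variable has such rows because it occurs in a clause. A variable without occurrences would give
  zero columns.\<close>

lemma full_column_rank_crp_matrix: "full_column_rank (real_mat (crp_matrix Cs))"
proof (rule full_column_rank_if_kernel_trivial)
  let ?vs = "used_vars Cs" and ?B = "real_mat (crp_matrix Cs)"
  fix d assume d: "d \<in> carrier_vec (dim_col ?B)" and zero: "?B *\<^sub>v d = 0\<^sub>v (dim_row ?B)"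
  have d': "d \<in> carrier_vec (3 * length ?vs)" using d by simp
  have row0: "row_val q (\<lambda>j. d $ j) = 0" if q: "q \<in> set (matrix_rows ?vs Cs)" for q
  proof -
    obtain i where "i < length (matrix_rows ?vs Cs)" "q = matrix_rows ?vs Cs ! i"
      using q by (auto simp: in_set_conv_nth)
    then show ?thesis using crp_matrix_mult[OF d'] zero by simp
  qed
  have "d $ i = 0" if i: "i < 3 * length ?vs" for i
  proof -
    let ?v = "?vs ! (i div 3)" and ?D = "var_coords ?vs (\<lambda>j. d $ j)"
    have a: "i div 3 < length ?vs" using i by auto
    then have "?v \<in> set (clause_vars Cs)" using nth_mem[OF a] by simp
    then obtain C l where l: "C \<in> set Cs" "l \<in> set C" "lit_var l = ?v"
      by (auto simp: clause_vars_def)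
    have "gsum (?D ?v) - 2 * ?D ?v t = 0" if t: "t < 3" for t
    proof -
      have "gadget_row ?vs l t \<in> set (matrix_rows ?vs Cs)"
        using l t by (force simp: matrix_rows_def clause_rows_def literal_rows_def)
      from row0[OF this] show ?thesis
        using row_val_gadget_row[OF distinct_used_vars[of Cs], of l t "\<lambda>j. d $ j"] l t
          \<open>?v \<in> set (clause_vars Cs)\<close> by simp
    qed
    \<comment> \<open>Adding the three equations gives 3S - 2S = 0 for the sum S of the coordinates,
      and then each coordinate vanishes.\<close>
    from this[of 0] this[of 1] this[of 2]
    have "?D ?v 0 = 0 \<and> ?D ?v 1 = 0 \<and> ?D ?v 2 = 0"
      by (simp add: gsum_def)
    moreover have "i mod 3 = 0 \<or> i mod 3 = 1 \<or> i mod 3 = 2" by auto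
    ultimately have "?D ?v (i mod 3) = 0" by auto
    then show ?thesis
      using a by (simp add: var_coords_def var_index_nth distinct_used_vars)
  qed
  then show "d = 0\<^sub>v (dim_col ?B)" using d by (intro eq_vecI) auto
qed

section \<open>The reduction\<close>

text \<open>The number is kept in unary because in prefix notation this is \<open>m\<close> copies
  of one word followed by \<open>Num 0\<close>, which \<open>tally\<close> can write; its length is
  linear in \<open>m\<close>.\<close>

fun ones :: "nat \<Rightarrow> rexp" where
  "ones 0 = Num 0"
| "ones (Suc m) = Add (Num 1) (ones m)"

text \<open>With the constants listed as [\<delta>, \<epsilon>, p], \<open>Par 1\<close> is
  \<epsilon> and \<open>Par 2\<close> is \<open>p\<close>; the value is
  \<open>yes_cost p \<epsilon>\<close>.\<close>

definition unit_cost :: rexp where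
  "unit_cost =
     Add (Add (Mul (Par 1) (Pow (Div (Num 4) (Num 3)) (Par 2)))
              (Mul (Sub (Num 1) (Par 1)) (Pow (Num 2) (Par 2))))
         (Mul (Num 3) (Add (Num 2) (Pow (Div (Num 4) (Num 3)) (Par 2))))"

definition crp_radius :: "nat \<Rightarrow> rexp" where
  "crp_radius m = Pow (Mul (ones m) unit_cost) (Div (Num 1) (Par 2))"

text \<open>Averaged over the clauses, this bounds the p-th power of the norm after rounding along
  an assignment that satisfies the fraction \<open>f\<close>; \<open>no_cost\<close> is the
  corresponding lower bound at the center. Their quotient at \<epsilon> and \<delta> is the p-th
  power of the gap.\<close>

definition yes_cost :: "real \<Rightarrow> real \<Rightarrow> real" where
  "yes_cost p f = f * (4/3) powr p + (1 - f) * 2 powr p + 3 * (2 + (4/3) powr p)"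

definition no_cost :: "real \<Rightarrow> real \<Rightarrow> real" where
  "no_cost p f = f * (10 / 2 powr p) + (1 - f) * ((3/2) powr p + 9 / 2 powr p)"

lemma gap_factor_eq: "gap_factor \<delta> \<epsilon> p = (no_cost p \<delta> / yes_cost p \<epsilon>) powr (1 / p)"
  by (simp add: gap_factor_def no_cost_def yes_cost_def)

lemma rexp_val_crp_radius:
  "rexp_val [\<delta>, \<epsilon>, p] (crp_radius m) = (m * yes_cost p \<epsilon>) powr (1 / p)"
proof -
  have "rexp_val cs (ones m) = m" for cs by (induction m) auto
  then show ?thesis by (simp add: crp_radius_def unit_cost_def yes_cost_def numeral_2_eq_2)
qed

lemma enc_rexp_ones:
  "enc_rexp (ones m) = concat (replicate m (''+'' @ enc_rexp (Num 1))) @ enc_rexp (Num 0)"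
  by (induction m) auto

lemma enc_crp_radius:
  "enc_rexp (crp_radius m) = ''^*'' @ concat (replicate m (''+'' @ enc_rexp (Num 1))) @
     enc_rexp (Num 0) @ enc_rexp unit_cost @ enc_rexp (Div (Num 1) (Par 2))"
  unfolding crp_radius_def enc_rexp.simps(5,7) enc_rexp_ones by simp

lemma yes_cost_pos:
  assumes "0 \<le> f" "f \<le> 1"
  shows "0 < yes_cost p f"
proof -
  have "0 < a + b + (6 + 3 * c)" if "0 \<le> a" "0 \<le> b" "0 \<le> c" for a b c :: real
    using that by linarith
  from this[of "f * (4/3) powr p" "(1 - f) * 2 powr p" "(4/3) powr p"] assms show ?thesis
    by (simp add: yes_cost_def)
qed

lemma no_cost_eq:
  "no_cost p f = (3/2) powr p + 9 * (1 / 2 powr p) - f * ((3/2) powr p - 1 / 2 powr p)"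
proof -
  define h where "h = 1 / 2 powr p"
  have h: "10 / 2 powr p = 10 * h" "9 / 2 powr p = 9 * h" by (simp_all add: h_def)
  show ?thesis
    unfolding no_cost_def h h_def[symmetric] by (simp add: algebra_simps)
qed

lemma half_powr_less:
  assumes "1 \<le> p"
  shows "1 / 2 powr p < (3/2::real) powr p"
proof -
  have "3 powr 1 \<le> (3::real) powr p" using assms by (intro powr_mono) auto
  then show ?thesis by (simp add: powr_divide divide_strict_right_mono)
qed

lemma no_cost_pos:
  assumes "f \<le> 1" "1 \<le> p"
  shows "0 < no_cost p f"
proof -
  have "0 < t + 9 * h - f * (t - h)" if "0 < h" "h < t" for h t :: real
  proof -
    have "f * (t - h) \<le> t - h"
      using mult_right_mono[OF assms(1), of "t - h"] that by simp
    with that show ?thesis by linarith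
  qed
  then show ?thesis
    unfolding no_cost_eq by this (use half_powr_less[OF assms(2)] in simp_all)
qed

lemma yes_cost_antimono:
  assumes "f \<le> f'" "0 \<le> p"
  shows "yes_cost p f' \<le> yes_cost p f"
proof -
  have "(4/3) powr p \<le> (2::real) powr p" using assms(2) by (intro powr_mono2) auto
  then have "0 \<le> (f' - f) * (2 powr p - (4/3) powr p)" using assms(1) by simp
  then show ?thesis by (simp add: yes_cost_def algebra_simps)
qed

text \<open>Satisfying a clause saves (3/2)^p - (1/2)^p > 0. Strictness matters: a NO instance must
  lie strictly beyond the scaled radius.\<close>

lemma no_cost_strict_antimono:
  assumes "f < f'" "1 \<le> p"
  shows "no_cost p f' < no_cost p f"
  using mult_strict_right_mono[OF assms(1), of "(3/2) powr p - 1 / 2 powr p"] half_powr_less[OF assms(2)]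
  unfolding no_cost_eq by linarith

section \<open>Values of formulas\<close>

lemma finite_range_sat_fraction: "finite (range (sat_fraction \<phi>))"
proof (rule finite_subset)
  show "range (sat_fraction \<phi>) \<subseteq> (\<lambda>k. real k / real (length (snd \<phi>))) ` {..length (snd \<phi>)}"
    unfolding sat_fraction_def by (auto simp: length_filter_le)
qed simp

lemma sat_fraction_le_formula_val: "sat_fraction \<phi> \<sigma> \<le> formula_val \<phi>"
  unfolding formula_val_def by (intro Max_ge finite_range_sat_fraction) auto

lemma formula_val_attained: obtains \<sigma> where "sat_fraction \<phi> \<sigma> = formula_val \<phi>"
proof -
  have "formula_val \<phi> \<in> range (sat_fraction \<phi>)"
    unfolding formula_val_def by (intro Max_in finite_range_sat_fraction) auto
  then show ?thesis using that by auto
qed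

lemma sat_fraction_bounds: "0 \<le> sat_fraction \<phi> \<sigma>" "sat_fraction \<phi> \<sigma> \<le> 1"
  by (auto simp: sat_fraction_def divide_le_eq_1 length_filter_le)

lemma formula_val_bounds: "0 \<le> formula_val \<phi>" "formula_val \<phi> \<le> 1"
proof -
  obtain \<sigma> where "sat_fraction \<phi> \<sigma> = formula_val \<phi>" by (rule formula_val_attained)
  then show "0 \<le> formula_val \<phi>" "formula_val \<phi> \<le> 1"
    using sat_fraction_bounds[of \<phi> \<sigma>] by simp_all
qed

lemma sum_list_if:
  fixes a b :: real
  assumes "xs \<noteq> []"
  shows "(\<Sum>x\<leftarrow>xs. if P x then a else b) = length xs *
    (length (filter P xs) / length xs * a + (1 - length (filter P xs) / length xs) * b)"
proof -
  have eq: "(\<Sum>x\<leftarrow>xs. if P x then a else b) =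
      length (filter P xs) * a + (real (length xs) - length (filter P xs)) * b"
    by (induction xs) (auto simp: algebra_simps)
  show ?thesis unfolding eq using assms by (simp add: field_simps)
qed

lemma clause_cost_nonneg: "0 \<le> clause_cost p D C"
  unfolding clause_cost_def gcost_def
  by (intro add_nonneg_nonneg sum_list_nonneg) (auto intro: sum_nonneg)

text \<open>The coordinates of an actual vector agree with the abstract rounding only for listed
  variables and indices below 3, and a clause sees nothing else.\<close>

lemma clause_cost_cong:
  assumes "\<And>v j. v \<in> lit_var ` set C \<Longrightarrow> j < 3 \<Longrightarrow> D v j = D' v j"
  shows "clause_cost p D C = clause_cost p D' C"
proof -
  have gsum: "gsum (D (lit_var l)) = gsum (D' (lit_var l))" if "l \<in> set C" for l
    using assms that by (simp add: gsum_def)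
  moreover have "gcost p (D (lit_var l)) = gcost p (D' (lit_var l))" if "l \<in> set C" for l
    unfolding gcost_def gsum[OF that] using assms that by (intro sum.cong) auto
  ultimately have "map (lit_term D) C = map (lit_term D') C"
    "map (\<lambda>l. gcost p (D (lit_var l))) C = map (\<lambda>l. gcost p (D' (lit_var l))) C"
    by (auto simp: lit_term_def)
  then show ?thesis unfolding clause_cost_def by (metis (no_types))
qed

lemma unit_cube_nonempty: "vec k (\<lambda>_. 1/2) \<in> unit_cube k"
  by (simp add: unit_cube_def)

lemma binary_subset_integer: "binary_vecs k \<subseteq> integer_vecs k"
  by (fastforce simp: binary_vecs_def integer_vecs_def)

lemma bdd_below_pnorm: "bdd_below ((\<lambda>x. pnorm p (f x)) ` S)"
  by (rule bdd_belowI[of _ 0]) (auto simp: pnorm_def)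

section \<open>Distances to binary and to lattice points\<close>

context
  fixes n :: nat and Cs :: "clause list" and p :: real
  assumes F: "nae_e3_formula (n, Cs)" and p: "1 \<le> p"
begin

lemma formula_clauses: "Cs \<noteq> []" "C \<in> set Cs \<Longrightarrow> length C = 3"
    "C \<in> set Cs \<Longrightarrow> lit_var ` set C \<subseteq> set (used_vars Cs)"
  using F by (auto simp: nae_e3_formula_def clause_vars_def)

text \<open>The assignment is left arbitrary: an optimal one bounds the linear discrepancy, and any
  fixed one shows that the supremum in the covering radius is over a bounded set.\<close>

lemma dist_upper:
  assumes w: "w \<in> unit_cube (3 * length (used_vars Cs))"
  shows "\<exists>x\<in>binary_vecs (3 * length (used_vars Cs)).
    pnorm p (real_mat (crp_matrix Cs) *\<^sub>v (w - x)) \<le>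
      (length Cs * yes_cost p (sat_fraction (n, Cs) \<sigma>)) powr (1 / p)"
proof -
  let ?vs = "used_vars Cs"
  let ?W = "var_coords ?vs (\<lambda>j. w $ j)"
  have idx: "3 * var_index ?vs v + j < 3 * length ?vs" if "v \<in> set ?vs" "j < 3" for v j
    using var_index(1)[OF that(1)] that(2) by linarith
  have "0 \<le> ?W v j \<and> ?W v j \<le> 1" if "v \<in> set ?vs" "j < 3" for v j
    using w idx[OF that] unfolding unit_cube_def var_coords_def by blast
  note rounding = clause_cost_upper[where \<sigma> = \<sigma>, OF this p]
  obtain X where X: "\<forall>v j. X v j \<in> {0, 1}"
    and cost: "\<forall>C. length C = 3 \<longrightarrow> lit_var ` set C \<subseteq> set ?vs \<longrightarrow>
      clause_cost p (\<lambda>v j. ?W v j - X v j) C \<le>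
       (if nae_sat \<sigma> C then (4/3) powr p else 2 powr p) + 3 * (2 + (4/3) powr p)"
    by (rule rounding)
  define x where "x = vec (3 * length ?vs) (\<lambda>i. X (?vs ! (i div 3)) (i mod 3))"
  have x: "x \<in> binary_vecs (3 * length ?vs)"
    using X by (auto simp: x_def binary_vecs_def)
  have carrier: "w \<in> carrier_vec (3 * length ?vs)" "x \<in> carrier_vec (3 * length ?vs)"
    using w x by (auto simp: unit_cube_def binary_vecs_def)
  have coords: "var_coords ?vs (\<lambda>j. (w - x) $ j) v j = ?W v j - X v j" if "v \<in> set ?vs" "j < 3" for v j
    using idx[OF that] carrier that var_index(2)[OF that(1)] by (simp add: var_coords_def x_def)
  have "(\<Sum>C\<leftarrow>Cs. clause_cost p (var_coords ?vs (\<lambda>j. (w - x) $ j)) C) \<le>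
      (\<Sum>C\<leftarrow>Cs. if nae_sat \<sigma> C then (4/3) powr p + 3 * (2 + (4/3) powr p)
        else 2 powr p + 3 * (2 + (4/3) powr p))"
  proof (rule sum_list_mono)
    fix C assume C: "C \<in> set Cs"
    have "clause_cost p (var_coords ?vs (\<lambda>j. (w - x) $ j)) C = clause_cost p (\<lambda>v j. ?W v j - X v j) C"
      using coords formula_clauses(3)[OF C] by (intro clause_cost_cong) auto
    then show "clause_cost p (var_coords ?vs (\<lambda>j. (w - x) $ j)) C \<le>
        (if nae_sat \<sigma> C then (4/3) powr p + 3 * (2 + (4/3) powr p)
          else 2 powr p + 3 * (2 + (4/3) powr p))"
      using cost[rule_format, OF formula_clauses(2,3)[OF C]] by (simp split: if_splits)
  qed
  also have "\<dots> = length Cs * yes_cost p (sat_fraction (n, Cs) \<sigma>)"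
    unfolding sum_list_if[OF formula_clauses(1)] by (simp add: sat_fraction_def yes_cost_def algebra_simps)
  finally have "pnorm p (real_mat (crp_matrix Cs) *\<^sub>v (w - x)) \<le>
      (length Cs * yes_cost p (sat_fraction (n, Cs) \<sigma>)) powr (1 / p)"
    unfolding pnorm_crp_matrix[OF minus_carrier_vec[OF carrier]]
    using p by (intro powr_mono2 sum_list_nonneg) (auto simp: clause_cost_nonneg)
  with x show ?thesis by blast
qed

text \<open>The center is the same for all \<open>x\<close>, whereas the assignment is read off from
  \<open>x\<close> by the signs of the gadget sums. Whichever assignment arises, it satisfies at
  most the fraction \<open>formula_val\<close>, and \<open>no_cost\<close> decreases in that
  fraction.\<close>

lemma dist_lower:
  assumes x: "x \<in> integer_vecs (3 * length (used_vars Cs))"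
  shows "(length Cs * no_cost p (formula_val (n, Cs))) powr (1 / p) \<le>
    pnorm p (real_mat (crp_matrix Cs) *\<^sub>v (vec (3 * length (used_vars Cs)) (\<lambda>_. 1/2) - x))"
proof -
  let ?vs = "used_vars Cs"
  let ?w = "vec (3 * length ?vs) (\<lambda>_. 1/2::real)" and ?X = "var_coords ?vs (\<lambda>j. x $ j)"
  define \<sigma> where "\<sigma> v = (0 < gsum (\<lambda>j. 1/2 - ?X v j))" for v
  have idx: "3 * var_index ?vs v + j < 3 * length ?vs" if "v \<in> set ?vs" "j < 3" for v j
    using var_index(1)[OF that(1)] that(2) by linarith
  have int: "?X v j \<in> \<int>" if "v \<in> set ?vs" "j < 3" for v j
    using x idx[OF that] unfolding integer_vecs_def var_coords_def by blast
  have carrier: "?w \<in> carrier_vec (3 * length ?vs)" "x \<in> carrier_vec (3 * length ?vs)"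
    using x by (auto simp: integer_vecs_def)
  have coords: "var_coords ?vs (\<lambda>j. (?w - x) $ j) v j = 1/2 - ?X v j" if "v \<in> set ?vs" "j < 3" for v j
    using idx[OF that] carrier by (simp add: var_coords_def)
  have "length Cs * no_cost p (formula_val (n, Cs)) \<le> length Cs * no_cost p (sat_fraction (n, Cs) \<sigma>)"
    using sat_fraction_le_formula_val[of "(n, Cs)" \<sigma>] no_cost_strict_antimono[OF _ p]
    by (intro mult_left_mono) (auto simp: le_less)
  also have "\<dots> = (\<Sum>C\<leftarrow>Cs. if nae_sat \<sigma> C then 10 / 2 powr p else (3/2) powr p + 9 / 2 powr p)"
    unfolding sum_list_if[OF formula_clauses(1)] by (simp add: sat_fraction_def no_cost_def)
  also have "\<dots> \<le> (\<Sum>C\<leftarrow>Cs. clause_cost p (var_coords ?vs (\<lambda>j. (?w - x) $ j)) C)"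
  proof (rule sum_list_mono)
    fix C assume C: "C \<in> set Cs"
    have "clause_cost p (var_coords ?vs (\<lambda>j. (?w - x) $ j)) C = clause_cost p (\<lambda>v j. 1/2 - ?X v j) C"
      using coords formula_clauses(3)[OF C] by (intro clause_cost_cong) auto
    then show "(if nae_sat \<sigma> C then 10 / 2 powr p else (3/2) powr p + 9 / 2 powr p) \<le>
        clause_cost p (var_coords ?vs (\<lambda>j. (?w - x) $ j)) C"
      using clause_cost_lower[OF int p formula_clauses(2,3)[OF C]] unfolding \<sigma>_def by simp
  qed
  finally show ?thesis
    unfolding pnorm_crp_matrix[OF minus_carrier_vec[OF carrier]]
    using p no_cost_pos[OF formula_val_bounds(2) p, of "(n, Cs)"] by (intro powr_mono2) simp_all
qed

lemma lindisc_upper: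
  "lindisc p (real_mat (crp_matrix Cs)) \<le> (length Cs * yes_cost p (formula_val (n, Cs))) powr (1 / p)"
proof -
  obtain \<sigma> where \<sigma>: "sat_fraction (n, Cs) \<sigma> = formula_val (n, Cs)" by (rule formula_val_attained)
  show ?thesis
    unfolding lindisc_def
  proof (rule cSUP_least)
    show "unit_cube (dim_col (real_mat (crp_matrix Cs))) \<noteq> {}"
      using unit_cube_nonempty by blast
    fix w assume "w \<in> unit_cube (dim_col (real_mat (crp_matrix Cs)))"
    then obtain x where x: "x \<in> binary_vecs (3 * length (used_vars Cs))"
      "pnorm p (real_mat (crp_matrix Cs) *\<^sub>v (w - x)) \<le>
        (length Cs * yes_cost p (formula_val (n, Cs))) powr (1 / p)"
      using dist_upper[of w \<sigma>] \<sigma> by auto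
    show "(INF x\<in>binary_vecs (dim_col (real_mat (crp_matrix Cs))). pnorm p (real_mat (crp_matrix Cs) *\<^sub>v (w - x)))
        \<le> (length Cs * yes_cost p (formula_val (n, Cs))) powr (1 / p)"
      using x by (intro cINF_lower2[OF bdd_below_pnorm, of x]) auto
  qed
qed

lemma covering_radius_lower:
  "(length Cs * no_cost p (formula_val (n, Cs))) powr (1 / p) \<le> covering_radius p (real_mat (crp_matrix Cs))"
proof -
  let ?k = "3 * length (used_vars Cs)" and ?B = "real_mat (crp_matrix Cs)"
  let ?dist = "\<lambda>w. INF x\<in>integer_vecs ?k. pnorm p (?B *\<^sub>v (w - x))"
  have ne: "integer_vecs ?k \<noteq> {}"
  proof -
    have "0\<^sub>v ?k \<in> integer_vecs ?k" by (simp add: integer_vecs_def)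
    then show ?thesis by blast
  qed
  have "(length Cs * no_cost p (formula_val (n, Cs))) powr (1 / p) \<le> ?dist (vec ?k (\<lambda>_. 1/2))"
    by (rule cINF_greatest[OF ne dist_lower])
  also have "\<dots> \<le> (SUP w\<in>unit_cube ?k. ?dist w)"
  proof (rule cSUP_upper[OF unit_cube_nonempty])
    \<comment> \<open>A supremum of reals is an upper bound only for bounded sets. Binary points are
      integer points, so the rounding bound also limits the distance to the lattice.\<close>
    show "bdd_above (?dist ` unit_cube ?k)"
    proof (rule bdd_aboveI2)
      fix w assume "w \<in> unit_cube ?k"
      then obtain x where x: "x \<in> binary_vecs ?k"
        "pnorm p (?B *\<^sub>v (w - x)) \<le> (length Cs * yes_cost p (sat_fraction (n, Cs) (\<lambda>_. True))) powr (1 / p)"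
        using dist_upper[of w "\<lambda>_. True"] by auto
      then show "?dist w \<le> (length Cs * yes_cost p (sat_fraction (n, Cs) (\<lambda>_. True))) powr (1 / p)"
        using binary_subset_integer by (intro cINF_lower2[OF bdd_below_pnorm, of x]) auto
    qed
  qed
  finally show ?thesis by (simp add: covering_radius_def)
qed

end

section \<open>The mapping reduction\<close>

definition to_crp :: "formula \<Rightarrow> crp_instance" where
  "to_crp \<phi> = (crp_matrix (snd \<phi>), crp_radius (length (snd \<phi>)))"

lemma polytime_to_crp: "polytime_map (nae_e3_sat \<delta> \<epsilon>) (bin_gap_crp cs p \<gamma>) to_crp"
proof -
  \<comment> \<open>The encoded radius splits around the unary sum: the instance separator and the
    symbols for power and product come before it, one summand is written per clause, and
    \<open>?w2\<close> is the constant rest.\<close>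
  let ?w2 = "enc_rexp (Num 0) @ enc_rexp unit_cost @ enc_rexp (Div (Num 1) (Par 2))"
  obtain P where "\<forall>\<phi>. nae_e3_formula \<phi> \<longrightarrow>
     computes_within (machine (reduction ''#^*'' (''+'' @ enc_rexp (Num 1)) ?w2)) (enc_formula \<phi>)
       (enc_rows (matrix_rows (used_vars (snd \<phi>)) (snd \<phi>)) @ ''#^*'' @
          concat (replicate (length (snd \<phi>)) (''+'' @ enc_rexp (Num 1))) @ ?w2)
       (poly P (length (enc_formula \<phi>)))"
    using reduction_polytime[of "''#^*''" "''+'' @ enc_rexp (Num 1)" ?w2] by blast
  then show ?thesis
    unfolding polytime_map_def
    by (intro exI[of _ "machine (reduction ''#^*'' (''+'' @ enc_rexp (Num 1)) ?w2)"] exI[of _ P])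
      (simp add: wf_tm_machine nae_e3_sat_def bin_gap_crp_def to_crp_def enc_mat_crp_matrix
        enc_crp_radius del: enc_rexp.simps)
qed

theorem theorem3p7:
  fixes \<delta> \<epsilon> p :: real
  assumes "0 < \<delta>" and "\<delta> \<le> \<epsilon>" and "\<epsilon> \<le> 1" and "1 \<le> p"
  shows "polytime_reducible (nae_e3_sat \<delta> \<epsilon>)
           (bin_gap_crp [\<delta>, \<epsilon>, p] p (gap_factor \<delta> \<epsilon> p))"
proof -
  let ?cs = "[\<delta>, \<epsilon>, p]"
  have yes0: "0 < yes_cost p \<epsilon>" and no0: "0 < no_cost p \<delta>"
    using assms by (auto intro: yes_cost_pos no_cost_pos)
  \<comment> \<open>A formula has a clause, whose literals supply a column, and the positive number
    of clauses makes the radius positive.\<close>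
  have inst: "to_crp (n, Cs) \<in> crp_instances ?cs" if F: "nae_e3_formula (n, Cs)" for n Cs
  proof -
    have "Cs \<noteq> []" using F by (simp add: nae_e3_formula_def)
    then obtain C where C: "C \<in> set Cs" by (cases Cs) auto
    have "C \<noteq> []" using formula_clauses(2)[OF F assms(4) C] by auto
    then have "set (used_vars Cs) \<noteq> {}" using formula_clauses(3)[OF F assms(4) C] by (cases C) auto
    then have "used_vars Cs \<noteq> []" by (auto simp del: set_used_vars)
    moreover note \<open>Cs \<noteq> []\<close>
    ultimately show ?thesis
      using yes0 by (simp add: to_crp_def crp_instances_def full_column_rank_crp_matrix rexp_val_crp_radius)
  qed
  have yes: "lindisc p (real_mat (crp_matrix Cs)) \<le> rexp_val ?cs (crp_radius (length Cs))"
    if F: "nae_e3_formula (n, Cs)" and val: "\<epsilon> \<le> formula_val (n, Cs)" for n Cs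
  proof -
    have "0 \<le> yes_cost p (formula_val (n, Cs))"
      by (intro less_imp_le yes_cost_pos formula_val_bounds)
    then have "(length Cs * yes_cost p (formula_val (n, Cs))) powr (1 / p) \<le>
        (length Cs * yes_cost p \<epsilon>) powr (1 / p)"
      using yes_cost_antimono[OF val, of p] assms(4) by (intro powr_mono2 mult_left_mono) auto
    with lindisc_upper[OF F assms(4)] show ?thesis
      unfolding rexp_val_crp_radius by linarith
  qed
  have no: "gap_factor \<delta> \<epsilon> p * rexp_val ?cs (crp_radius (length Cs)) < covering_radius p (real_mat (crp_matrix Cs))"
    if F: "nae_e3_formula (n, Cs)" and val: "formula_val (n, Cs) < \<delta>" for n Cs
  proof -
    have m: "0 < length Cs" using F by (simp add: nae_e3_formula_def)
    \<comment> \<open>The factor \<open>yes_cost p \<epsilon>\<close> of the radius cancels against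
      the denominator of the gap, leaving the p-th root of \<open>no_cost p \<delta>\<close> times
      the number of clauses.\<close>
    have "gap_factor \<delta> \<epsilon> p * rexp_val ?cs (crp_radius (length Cs)) =
        (no_cost p \<delta> / yes_cost p \<epsilon> * (length Cs * yes_cost p \<epsilon>)) powr (1 / p)"
      unfolding gap_factor_eq rexp_val_crp_radius
      by (rule powr_mult[symmetric])
    also have "\<dots> = (length Cs * no_cost p \<delta>) powr (1 / p)"
      using yes0 by (simp add: mult.commute)
    also have "\<dots> < (length Cs * no_cost p (formula_val (n, Cs))) powr (1 / p)"
      using no_cost_strict_antimono[OF val assms(4)] no0 m assms(4)
      by (intro powr_less_mono2 mult_strict_left_mono) auto
    also have "\<dots> \<le> covering_radius p (real_mat (crp_matrix Cs))"
      by (rule covering_radius_lower[OF F assms(4)])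
    finally show ?thesis .
  qed
  have "polytime_mapping_reduction (nae_e3_sat \<delta> \<epsilon>) (bin_gap_crp ?cs p (gap_factor \<delta> \<epsilon> p)) to_crp"
    unfolding polytime_mapping_reduction_def
    using polytime_to_crp inst yes no
    by (auto simp: nae_e3_sat_def bin_gap_crp_def to_crp_def)
  then show ?thesis unfolding polytime_reducible_def by blast
qed

end
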